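(* Let $n\ge1$ be an integer and let $\kappa\in\mathbb{R}$ satisfy $|\kappa|<1/\sqrt2$. Then, for every $a\in\mathbb{R}^{n+1}$ satisfying $\sum_{j=1}^{n+1}a_j=\kappa$ and $\sum_{j=1}^{n+1}a_j^2=1$, one has $$\operatorname{vol}_{n-1}(\Delta_n\cap H_a)\le \frac{\sqrt{n+1-\kappa^2}}{(n-1)!}\,\frac{1}{\sqrt{2-\kappa^2}}.$$ Equality holds, up to permutation of the coordinates, at $$a=\left(\frac{\kappa}{2}+\sqrt{\frac12-\frac{\kappa^2}{4}},\ \frac{\kappa}{2}-\sqrt{\frac12-\frac{\kappa^2}{4}},\ 0,\dots,0\right).$$
   Context: $\Delta_n=\{x\in\mathbb{R}^{n+1}: x_j\ge 0 \text{ for all } j,\ \sum_{j=1}^{n+1}x_j=1\}$. For $a\in\mathbb{R}^{n+1}$, $H_a=\{x\in\mathbb{R}^{n+1}:\langle x,a\rangle=0\}$ is the hyperplane through the origin orthogonal to $a$ (it need not pass through the barycenter of $\Delta_n$). $\operatorname{vol}_{n-1}$ is $(n-1)$-dimensional Lebesgue (Hausdorff) measure, normalized so that unit cubes have volume $1$. *)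

theory Defs
  imports "HOL-Analysis.Analysis"
begin

definition unit_simplex :: "(real ^ 'm) set" where
  "unit_simplex = {x. (\<forall>j. 0 \<le> x $ j) \<and> (\<Sum>j\<in>UNIV. x $ j) = 1}"

definition hyperplane :: "real ^ 'm \<Rightarrow> (real ^ 'm) set" where
  "hyperplane a = {x. x \<bullet> a = 0}"

definition orthonormal_frame :: "nat \<Rightarrow> (nat \<Rightarrow> 'a::euclidean_space) \<Rightarrow> bool" where
  "orthonormal_frame k b \<longleftrightarrow> (\<forall>i<k. \<forall>j<k. b i \<bullet> b j = (if i = j then 1 else 0))"

definition frame_map :: "nat \<Rightarrow> 'a \<times> (nat \<Rightarrow> 'a::euclidean_space) \<Rightarrow> (nat \<Rightarrow> real) \<Rightarrow> 'a" where
  "frame_map k = (\<lambda>(p, b) c. p + (\<Sum>i<k. c i *\<^sub>R b i))"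

text \<open>
  Coordinates in \<open>\<real>\<^sup>k\<close> are functions on \<open>{..<k}\<close>, so that \<open>k\<close> may be any natural number,
  including 0: the product measure over the empty index set is the unit mass at one point,
  so \<open>flat_vol 0\<close> of a point is 1.
\<close>

definition lebesgue_k :: "nat \<Rightarrow> (nat \<Rightarrow> real) measure" where
  "lebesgue_k k = completion (\<Pi>\<^sub>M i\<in>{..<k}. (lborel :: real measure))"

text \<open>
  The \<open>k\<close>-dimensional Lebesgue measure of a set \<open>S\<close> lying in some \<open>k\<close>-dimensional affine
  subspace: transport \<open>S\<close> to \<open>\<real>\<^sup>k\<close> by an isometric (affine, orthonormal) parametrization of
  such a subspace and measure it there. The value does not depend on the parametrization:
  two parametrizations of the same subspace differ by a rigid motion of \<open>\<real>\<^sup>k\<close>, and if \<open>S\<close> lies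
  in two different \<open>k\<close>-dimensional subspaces then it is a null set in both. The choice is
  unspecified, and the notion is not meant to be used, if no such subspace contains \<open>S\<close>.
\<close>

definition flat_vol :: "nat \<Rightarrow> 'a::euclidean_space set \<Rightarrow> ennreal" where
  "flat_vol k S =
     (let F = (SOME F. orthonormal_frame k (snd F)
                 \<and> S \<subseteq> frame_map k F ` space (lebesgue_k k))
      in emeasure (lebesgue_k k) {c \<in> space (lebesgue_k k). frame_map k F c \<in> S})"

end

theory Submission
  imports Defs "HOL-Probability.Distributions"
begin

text \<open>
  Let \<open>X = \<Sum>j. a j * E j\<close> with independent standard exponential \<open>E j\<close>. Integrating \<open>exp (- (\<Sum>j. x j))\<close>
  over the orthant along the two functionals \<open>\<Sum>j. x j\<close> and \<open>x \<bullet> a\<close> shows that the volume of the slice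
  is \<open>sqrt (n + 1 - \<kappa>\<^sup>2) / (n - 1)!\<close> times the value \<open>t\<close> at 0 of the density of \<open>X\<close>, so the claim
  becomes \<open>t\<^sup>2 (2 - \<kappa>\<^sup>2) \<le> 1\<close>. The density \<open>f\<close> of \<open>X\<close> is log-concave, being a convolution of exponential
  densities, and so are its iterated tail integrals; hence the sequence \<open>f(0)\<close>, \<open>P(X \<ge> 0)\<close>, \<open>E X\<^sub>+\<close>,
  \<open>E X\<^sub>+\<^sup>2 / 2\<close> is log-concave, and likewise for \<open>-X\<close>. Since \<open>E X = \<kappa>\<close> and \<open>E X\<^sup>2 = 1 + \<kappa>\<^sup>2\<close>, the bound on \<open>t\<close>
  is an elementary consequence. In the equality case \<open>f\<close> is a two-sided exponential density.
\<close>

section \<open>Log-concave functions and their tail integrals\<close>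

text \<open>On the positive side log-concavity gives \<open>t * m1 <= p^2\<close> and
  \<open>p * s1 <= m1^2\<close>, and likewise on the negative side; this still leaves the split
  \<open>p + q = 1\<close> of the mass free. What ties the two sides together is the mean,
  \<open>m1 - m2 = \<kappa>\<close>. For the two-sided exponential all these inequalities are
  equalities and \<open>p - q = t * \<kappa>\<close>; hence the proof compares
  \<open>t * \<kappa>\<close> with \<open>p - q\<close>. The main obstacle is that the claim
  concerns the single point 0, while a density is determined only almost everywhere. Two functions
  are therefore kept apart: a log-concave one built by convolution, and one built from slice
  volumes, whose value at 0 carries the wanted volume. They agree almost everywhere, and the second
  is controlled near 0 because the orthant is stable under adding nonnegative vectors. This requires
  coordinates of \<open>a\<close> of both signs, which the unit norm and
  \<open>|\<kappa>| < 1\<close> force.\<close>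

text \<open>
  Log-concavity as total positivity of order 2 of the kernel \<open>f (x - y)\<close>. In this form it makes
  sense for extended nonnegative functions and passes to integrals without finiteness conditions.
\<close>

definition logconc :: "(real \<Rightarrow> ennreal) \<Rightarrow> bool" where
  "logconc f \<longleftrightarrow> (\<forall>x y v. x \<le> y \<longrightarrow> 0 \<le> v \<longrightarrow> f x * f (y + v) \<le> f (x + v) * f y)"

definition tail :: "(real \<Rightarrow> ennreal) \<Rightarrow> real \<Rightarrow> ennreal" where
  "tail f x = (\<integral>\<^sup>+y. f y * indicator {x..} y \<partial>lborel)"

lemma logconcD: "logconc f \<Longrightarrow> x \<le> y \<Longrightarrow> 0 \<le> v \<Longrightarrow> f x * f (y + v) \<le> f (x + v) * f y"
  by (auto simp: logconc_def)

lemma borel_measurable_tail[measurable]: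
  assumes [measurable]: "f \<in> borel_measurable borel"
  shows "tail f \<in> borel_measurable borel"
proof -
  have "tail f = (\<lambda>x. \<integral>\<^sup>+y. f y * (if x \<le> y then 1 else 0) \<partial>lborel)"
    unfolding tail_def by (intro ext nn_integral_cong) (auto split: split_indicator)
  also have "\<dots> \<in> borel_measurable borel"
    by measurable
  finally show ?thesis .
qed

lemma nn_integral_shift:
  fixes c :: real
  assumes [measurable]: "f \<in> borel_measurable borel"
  shows "(\<integral>\<^sup>+y. f y \<partial>lborel) = (\<integral>\<^sup>+y. f (c + y) \<partial>lborel)"
  using nn_integral_real_affine[of f 1 c] by simp

lemma tail_shift:
  assumes [measurable]: "f \<in> borel_measurable borel"
  shows "tail f (x + c) = (\<integral>\<^sup>+y. f (y + c) * indicator {x..} y \<partial>lborel)"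
  unfolding tail_def
  by (subst nn_integral_shift[where c = c])
     (auto intro!: nn_integral_cong simp: add.commute split: split_indicator)

lemma tail_split:
  assumes [measurable]: "f \<in> borel_measurable borel" and "x \<le> y"
  shows "tail f x = (\<integral>\<^sup>+r. f r * indicator {x..<y} r \<partial>lborel) + tail f y"
  unfolding tail_def using assms(2)
  by (subst nn_integral_add[symmetric]) (auto intro!: nn_integral_cong split: split_indicator)

text \<open>Cutting the two longer rays at \<open>y\<close> and \<open>y + v\<close> produces the
  same product \<open>tail f y * tail f (y + v)\<close> on both sides. What remains pairs a point
  \<open>r < y\<close> with a point \<open>w >= y\<close>, where the inequality holds pointwise.
  Nothing is subtracted, so infinite values do no harm.\<close>

lemma logconc_tail:
  assumes [measurable]: "f \<in> borel_measurable borel" and lc: "logconc f"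
  shows "logconc (tail f)"
  unfolding logconc_def
proof (intro allI impI)
  fix x y v :: real assume xy: "x \<le> y" and v: "0 \<le> v"
  let ?A = "\<integral>\<^sup>+r. f r * indicator {x..<y} r \<partial>lborel"
  let ?A' = "\<integral>\<^sup>+r. f r * indicator {x+v..<y+v} r \<partial>lborel"
  have A': "?A' = (\<integral>\<^sup>+r. f (r + v) * indicator {x..<y} r \<partial>lborel)"
    by (subst nn_integral_shift[where c = v])
       (auto intro!: nn_integral_cong simp: add.commute split: split_indicator)
  have "?A * tail f (y + v)
      = (\<integral>\<^sup>+r. \<integral>\<^sup>+w. (f r * indicator {x..<y} r) * (f (w + v) * indicator {y..} w) \<partial>lborel \<partial>lborel)"
    by (simp add: tail_shift nn_integral_cmult nn_integral_multc)
  also have "\<dots> \<le> (\<integral>\<^sup>+r. \<integral>\<^sup>+w. (f (r + v) * indicator {x..<y} r) * (f w * indicator {y..} w) \<partial>lborel \<partial>lborel)"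
    by (intro nn_integral_mono) (auto split: split_indicator intro!: logconcD[OF lc] simp: v)
  also have "\<dots> = ?A' * tail f y"
    unfolding A' by (simp add: tail_def nn_integral_cmult nn_integral_multc)
  finally have "?A * tail f (y + v) \<le> ?A' * tail f y" .
  then show "tail f x * tail f (y + v) \<le> tail f (x + v) * tail f y"
    using xy by (simp add: tail_split[of f x y] tail_split[of f "x+v" "y+v"] distrib_right
      mult.commute[of "tail f y"] add_right_mono)
qed

text \<open>Both sides are integrals over \<open>u, v >= 0\<close>, with integrands
  \<open>f x * f (x + u + v)\<close> and \<open>f (x + u) * f (x + v)\<close>. Used for the density
  it yields \<open>t * m <= p^2\<close>, used for its tail it yields
  \<open>p * s <= m^2\<close>.\<close>

lemma logconc_tail_tail_le:
  assumes [measurable]: "f \<in> borel_measurable borel" and lc: "logconc f"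
  shows "f x * tail (tail f) x \<le> (tail f x)\<^sup>2"
proof -
  have t: "tail g x = (\<integral>\<^sup>+u. g (u + x) * indicator {0..} u \<partial>lborel)"
    if "g \<in> borel_measurable borel" for g x
    using tail_shift[OF that, of 0 x] by simp
  have "f x * tail (tail f) x
      = (\<integral>\<^sup>+u. \<integral>\<^sup>+v. f x * (f (v + (u + x)) * indicator {0..} v) * indicator {0..} u \<partial>lborel \<partial>lborel)"
    by (simp add: t nn_integral_cmult nn_integral_multc) (simp add: mult.assoc nn_integral_cmult)
  also have "\<dots> \<le> (\<integral>\<^sup>+u. \<integral>\<^sup>+v. (f (u + x) * indicator {0..} u) * (f (v + x) * indicator {0..} v) \<partial>lborel \<partial>lborel)"
  proof (intro nn_integral_mono)
    fix u v :: real
    have "f x * f (v + (u + x)) \<le> f (u + x) * f (v + x)" if "0 \<le> u" "0 \<le> v"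
      using logconcD[OF lc, of x "v + x" u] that by (simp add: ac_simps)
    then show "f x * (f (v + (u + x)) * indicator {0..} v) * indicator {0..} u
      \<le> (f (u + x) * indicator {0..} u) * (f (v + x) * indicator {0..} v)"
      by (auto split: split_indicator)
  qed
  also have "\<dots> = (tail f x)\<^sup>2"
    by (simp add: t nn_integral_cmult nn_integral_multc power2_eq_square)
  finally show ?thesis .
qed

lemma nn_integral_indicator_Icc_real:
  "(\<integral>\<^sup>+w. indicator {x..y} w \<partial>lborel) = ennreal (max 0 (y - x))"
  by (cases "x \<le> y") auto

text \<open>Fubini in the role of integration by parts: the tail is traded for a primitive of the
  weight. Two applications turn iterated tails at 0 into moments of the positive part.\<close>

lemma tail_weighted:
  assumes [measurable]: "f \<in> borel_measurable borel" "h \<in> borel_measurable borel"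
  shows "(\<integral>\<^sup>+w. h w * tail f w \<partial>lborel) = (\<integral>\<^sup>+y. f y * (\<integral>\<^sup>+w. h w * indicator {..y} w \<partial>lborel) \<partial>lborel)"
proof -
  have "(\<integral>\<^sup>+w. h w * tail f w \<partial>lborel)
      = (\<integral>\<^sup>+w. \<integral>\<^sup>+y. h w * (f y * (if w \<le> y then 1 else 0)) \<partial>lborel \<partial>lborel)"
    unfolding tail_def
    by (auto intro!: nn_integral_cong simp: nn_integral_cmult[symmetric] split: split_indicator)
  also have "\<dots> = (\<integral>\<^sup>+y. \<integral>\<^sup>+w. h w * (f y * (if w \<le> y then 1 else 0)) \<partial>lborel \<partial>lborel)"
    by (rule lborel_pair.Fubini') measurable
  also have "\<dots> = (\<integral>\<^sup>+y. f y * (\<integral>\<^sup>+w. h w * indicator {..y} w \<partial>lborel) \<partial>lborel)"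
    by (auto intro!: nn_integral_cong simp: nn_integral_cmult[symmetric] ac_simps split: split_indicator)
  finally show ?thesis .
qed

lemma tail_tail_eq:
  assumes [measurable]: "f \<in> borel_measurable borel"
  shows "tail (tail f) x = (\<integral>\<^sup>+y. f y * ennreal (max 0 (y - x)) \<partial>lborel)"
proof -
  have "tail (tail f) x = (\<integral>\<^sup>+w. indicator {x..} w * tail f w \<partial>lborel)"
    by (simp add: tail_def[of "tail f"] mult.commute)
  also have "\<dots> = (\<integral>\<^sup>+y. f y * (\<integral>\<^sup>+w. indicator {x..} w * indicator {..y} w \<partial>lborel) \<partial>lborel)"
    by (rule tail_weighted) auto
  also have "(\<lambda>y. \<integral>\<^sup>+w. indicator {x..} w * indicator {..y} w \<partial>lborel) = (\<lambda>y. ennreal (max 0 (y - x)))"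
    unfolding nn_integral_indicator_Icc_real[symmetric]
    by (intro ext nn_integral_cong) (auto split: split_indicator)
  finally show ?thesis .
qed

lemma nn_integral_linear_Icc:
  fixes y :: real
  shows "(\<integral>\<^sup>+w. ennreal (max 0 w) * indicator {..y} w \<partial>lborel) = ennreal ((max 0 y)\<^sup>2 / 2)"
proof (cases "0 \<le> y")
  case True
  have "(\<integral>\<^sup>+w. ennreal (max 0 w) * indicator {..y} w \<partial>lborel) = (\<integral>\<^sup>+w. ennreal w * indicator {0..y} w \<partial>lborel)"
    by (intro nn_integral_cong) (auto split: split_indicator)
  also have "\<dots> = ennreal (y\<^sup>2 / 2 - 0\<^sup>2 / 2)"
    using True by (intro nn_integral_FTC_Icc) (auto intro!: derivative_eq_intros)
  finally show ?thesis using True by simp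
next
  case False
  then have "(\<integral>\<^sup>+w. ennreal (max 0 w) * indicator {..y} w \<partial>lborel) = (\<integral>\<^sup>+w. 0 \<partial>(lborel :: real measure))"
    by (intro nn_integral_cong) (auto split: split_indicator)
  with False show ?thesis by simp
qed

lemma tail_tail_tail_eq:
  assumes [measurable]: "f \<in> borel_measurable borel"
  shows "tail (tail (tail f)) 0 = (\<integral>\<^sup>+y. f y * ennreal ((max 0 y)\<^sup>2 / 2) \<partial>lborel)"
  by (simp add: tail_tail_eq[of "tail f"] nn_integral_linear_Icc[symmetric] tail_weighted[symmetric] mult.commute)

section \<open>Convolution with exponential laws\<close>

definition expd :: "real \<Rightarrow> ennreal" where
  "expd t = ennreal (exp (- t)) * indicator {0..} t"

lemma borel_measurable_expd[measurable]: "expd \<in> borel_measurable borel"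
  by (auto simp: expd_def[abs_def])

lemma nn_integral_expd: "(\<integral>\<^sup>+t. expd t \<partial>lborel) = 1"
  using nn_intergal_power_times_exp_Ici[of 0] by (simp add: expd_def)

text \<open>The density of \<open>X + b * E\<close> when \<open>X\<close> has density
  \<open>f\<close> and \<open>E\<close> is an independent standard exponential. Averaging over
  \<open>E\<close>, instead of convolving with a density of \<open>b * E\<close>, keeps
  \<open>b = 0\<close> meaningful.\<close>

definition expconv :: "real \<Rightarrow> (real \<Rightarrow> ennreal) \<Rightarrow> real \<Rightarrow> ennreal" where
  "expconv b f x = (\<integral>\<^sup>+t. f (x - b * t) * expd t \<partial>lborel)"

lemma borel_measurable_expconv[measurable]:
  assumes [measurable]: "f \<in> borel_measurable borel"
  shows "expconv b f \<in> borel_measurable borel"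
  unfolding expconv_def[abs_def] by measurable

lemma expconv_0: 
  assumes [measurable]: "f \<in> borel_measurable borel"
  shows "expconv 0 f = f"
  by (auto simp: expconv_def nn_integral_cmult nn_integral_expd)

lemma logconc_mult: "logconc f \<Longrightarrow> logconc g \<Longrightarrow> logconc (\<lambda>x. f x * g x)"
  unfolding logconc_def
proof (intro allI impI)
  fix x y v :: real
  assume f: "\<forall>x y v. x \<le> y \<longrightarrow> 0 \<le> v \<longrightarrow> f x * f (y + v) \<le> f (x + v) * f y"
    and g: "\<forall>x y v. x \<le> y \<longrightarrow> 0 \<le> v \<longrightarrow> g x * g (y + v) \<le> g (x + v) * g y" and *: "x \<le> y" "0 \<le> v"
  have "(f x * f (y + v)) * (g x * g (y + v)) \<le> (f (x + v) * f y) * (g (x + v) * g y)"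
    using f g * by (intro mult_mono[of _ _ "g x * g (y + v)"]) auto
  then show "f x * g x * (f (y + v) * g (y + v)) \<le> f (x + v) * g (x + v) * (f y * g y)"
    by (simp add: ac_simps)
qed

lemma logconc_exp: "0 \<le> c \<Longrightarrow> logconc (\<lambda>x. ennreal (c * exp (d * x)))"
  by (simp add: logconc_def ennreal_mult[symmetric] exp_add distrib_left)

lemma logconc_reflect: "logconc f \<Longrightarrow> logconc (\<lambda>x. f (- x))"
  unfolding logconc_def
proof (intro allI impI)
  fix x y v :: real
  assume f: "\<forall>x y v. x \<le> y \<longrightarrow> 0 \<le> v \<longrightarrow> f x * f (y + v) \<le> f (x + v) * f y" and *: "x \<le> y" "0 \<le> v"
  show "f (- x) * f (- (y + v)) \<le> f (- (x + v)) * f (- y)"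
    using f[rule_format, of "- y - v" "- x - v" v] * by (simp add: mult.commute)
qed

lemma logconc_indicator_Ici: "logconc (indicator {0..})"
  by (auto simp: logconc_def split: split_indicator)

text \<open>Exponential tilting: substituting \<open>y = x - b * t\<close> shows that
  \<open>expconv b f\<close> is an exponential times the tail of \<open>f\<close> times an
  exponential. Products and tails preserve log-concavity.\<close>

lemma logconc_expconv_neg:
  assumes [measurable]: "f \<in> borel_measurable borel" and lc: "logconc f" and b: "b < 0"
  shows "logconc (expconv b f)"
proof -
  let ?\<phi> = "\<lambda>z. f z * ennreal (1 * exp (1 / b * z))"
  have "expconv b f x = ennreal (1 / (- b) * exp (- (1 / b) * x)) * tail ?\<phi> x" for x
  proof -
    have "tail ?\<phi> x = \<bar>- b\<bar> * (\<integral>\<^sup>+t. ?\<phi> (x + - b * t) * indicator {x..} (x + - b * t) \<partial>lborel)"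
      unfolding tail_def using b by (intro nn_integral_real_affine) auto
    also have "(\<integral>\<^sup>+t. ?\<phi> (x + - b * t) * indicator {x..} (x + - b * t) \<partial>lborel)
      = (\<integral>\<^sup>+t. ennreal (exp (1 / b * x)) * (f (x - b * t) * expd t) \<partial>lborel)"
      using b
    proof (intro nn_integral_cong)
      fix t
      have e: "exp (1 / b * (x + - b * t)) = exp (1 / b * x) * exp (- t)"
        using b by (simp add: exp_add[symmetric] field_simps)
      show "?\<phi> (x + - b * t) * indicator {x..} (x + - b * t)
        = ennreal (exp (1 / b * x)) * (f (x - b * t) * expd t)"
        unfolding e using b
        by (auto simp: expd_def ennreal_mult mult_le_0_iff ac_simps split: split_indicator)
    qed
    also have "\<dots> = ennreal (exp (1 / b * x)) * expconv b f x"
      by (simp add: expconv_def nn_integral_cmult)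
    finally have T: "tail ?\<phi> x = ennreal \<bar>- b\<bar> * (ennreal (exp (1 / b * x)) * expconv b f x)" .
    have cancel: "ennreal A * (ennreal B * (ennreal C * E)) = E"
      if "0 \<le> A" "0 \<le> B" "0 \<le> C" "A * B * C = 1" for A B C E
      using that by (simp add: mult.assoc[symmetric] ennreal_mult[symmetric])
    show ?thesis
      unfolding T using b by (intro cancel[symmetric]) (auto simp: exp_add[symmetric] divide_le_0_iff)
  qed
  then have "expconv b f = (\<lambda>x. ennreal (1 / (- b) * exp (- (1 / b) * x)) * tail ?\<phi> x)" by auto
  moreover have "logconc (\<lambda>x. ennreal (1 / (- b) * exp (- (1 / b) * x)) * tail ?\<phi> x)"
    using b lc by (intro logconc_mult logconc_exp logconc_tail) auto
  ultimately show ?thesis by (simp only:)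
qed

lemma logconc_expconv:
  assumes [measurable]: "f \<in> borel_measurable borel" and lc: "logconc f"
  shows "logconc (expconv b f)"
proof -
  consider "b = 0" | "b < 0" | "b > 0" by linarith
  then show ?thesis
  proof cases
    case 3
    have "expconv b f = (\<lambda>x. expconv (- b) (\<lambda>y. f (- y)) (- x))"
      by (auto simp: expconv_def)
    then show ?thesis using 3
      by (simp only:) (intro logconc_reflect[of "expconv (- b) (\<lambda>y. f (- y))"]
         logconc_expconv_neg logconc_reflect lc, auto)
  qed (use assms logconc_expconv_neg in \<open>auto simp: expconv_0\<close>)
qed

section \<open>Densities of sums of exponential variables\<close>

interpretation lborel_PiM: product_sigma_finite "\<lambda>_. lborel :: real measure"
  by standard

text \<open>
  \<open>f\<close> is a density of \<open>\<Sum>j\<in>J. a j * E j\<close>, where the \<open>E j\<close> are independent standard exponential variables.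
\<close>

definition sum_density :: "'i set \<Rightarrow> ('i \<Rightarrow> real) \<Rightarrow> (real \<Rightarrow> ennreal) \<Rightarrow> bool" where
  "sum_density J a f \<longleftrightarrow> f \<in> borel_measurable borel \<and>
     (\<forall>h \<in> borel_measurable borel.
       (\<integral>\<^sup>+x. h (\<Sum>j\<in>J. a j * x j) * (\<Prod>j\<in>J. expd (x j)) \<partial>(\<Pi>\<^sub>M j\<in>J. lborel)) = (\<integral>\<^sup>+y. h y * f y \<partial>lborel))"

lemma sum_density_measurable[measurable_dest]: "sum_density J a f \<Longrightarrow> f \<in> borel_measurable borel"
  by (simp add: sum_density_def)

lemma sum_densityD:
  "sum_density J a f \<Longrightarrow> h \<in> borel_measurable borel \<Longrightarrow>
    (\<integral>\<^sup>+x. h (\<Sum>j\<in>J. a j * x j) * (\<Prod>j\<in>J. expd (x j)) \<partial>(\<Pi>\<^sub>M j\<in>J. lborel)) = (\<integral>\<^sup>+y. h y * f y \<partial>lborel)"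
  by (simp add: sum_density_def)

text \<open>With the new coordinate fixed at \<open>t\<close>, the density for \<open>J\<close> is
  applied to the test function translated by \<open>a i * t\<close>; this is why
  \<open>sum_density\<close> quantifies over all \<open>h\<close>.\<close>

lemma sum_density_insert:
  assumes J: "finite J" "i \<notin> J" and f: "sum_density J a f"
  shows "sum_density (insert i J) a (expconv (a i) f)"
  unfolding sum_density_def
proof (intro conjI ballI)
  have [measurable]: "f \<in> borel_measurable borel" using f by (rule sum_density_measurable)
  show "expconv (a i) f \<in> borel_measurable borel" by simp
  fix h :: "real \<Rightarrow> ennreal" assume [measurable]: "h \<in> borel_measurable borel"
  have eq: "h (\<Sum>j\<in>insert i J. a j * (x(i := t)) j) * (\<Prod>j\<in>insert i J. expd ((x(i := t)) j))
    = expd t * (h (a i * t + (\<Sum>j\<in>J. a j * x j)) * (\<Prod>j\<in>J. expd (x j)))" for x t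
  proof -
    have "(\<Sum>j\<in>J. a j * (x(i := t)) j) = (\<Sum>j\<in>J. a j * x j)"
      "(\<Prod>j\<in>J. expd ((x(i := t)) j)) = (\<Prod>j\<in>J. expd (x j))"
      using J by (auto intro!: sum.cong prod.cong)
    then show ?thesis using J by (simp add: ac_simps)
  qed
  have "(\<integral>\<^sup>+x. h (\<Sum>j\<in>insert i J. a j * x j) * (\<Prod>j\<in>insert i J. expd (x j)) \<partial>(\<Pi>\<^sub>M j\<in>insert i J. lborel))
    = (\<integral>\<^sup>+t. \<integral>\<^sup>+x. expd t * (h (a i * t + (\<Sum>j\<in>J. a j * x j)) * (\<Prod>j\<in>J. expd (x j))) \<partial>(\<Pi>\<^sub>M j\<in>J. lborel) \<partial>lborel)"
    using J by (subst lborel_PiM.product_nn_integral_insert_rev) (simp_all only: eq, measurable)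
  also have "\<dots> = (\<integral>\<^sup>+t. expd t * (\<integral>\<^sup>+y. h (a i * t + y) * f y \<partial>lborel) \<partial>lborel)"
  proof (intro nn_integral_cong)
    fix t
    have "(\<integral>\<^sup>+x. expd t * (h (a i * t + (\<Sum>j\<in>J. a j * x j)) * (\<Prod>j\<in>J. expd (x j))) \<partial>(\<Pi>\<^sub>M j\<in>J. lborel))
      = expd t * (\<integral>\<^sup>+x. h (a i * t + (\<Sum>j\<in>J. a j * x j)) * (\<Prod>j\<in>J. expd (x j)) \<partial>(\<Pi>\<^sub>M j\<in>J. lborel))"
      by (rule nn_integral_cmult) measurable
    also have "(\<integral>\<^sup>+x. h (a i * t + (\<Sum>j\<in>J. a j * x j)) * (\<Prod>j\<in>J. expd (x j)) \<partial>(\<Pi>\<^sub>M j\<in>J. lborel))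
      = (\<integral>\<^sup>+y. h (a i * t + y) * f y \<partial>lborel)"
      by (rule sum_densityD[OF f, of "\<lambda>y. h (a i * t + y)"]) measurable
    finally show "(\<integral>\<^sup>+x. expd t * (h (a i * t + (\<Sum>j\<in>J. a j * x j)) * (\<Prod>j\<in>J. expd (x j))) \<partial>(\<Pi>\<^sub>M j\<in>J. lborel))
      = expd t * (\<integral>\<^sup>+y. h (a i * t + y) * f y \<partial>lborel)" .
  qed
  also have "\<dots> = (\<integral>\<^sup>+t. \<integral>\<^sup>+y. h y * (f (y - a i * t) * expd t) \<partial>lborel \<partial>lborel)"
  proof (intro nn_integral_cong)
    fix t
    have "(\<integral>\<^sup>+y. h (a i * t + y) * f y \<partial>lborel) = (\<integral>\<^sup>+y. h y * f (y - a i * t) \<partial>lborel)"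
      by (subst (2) nn_integral_shift[where c = "a i * t"]) auto
    then show "expd t * (\<integral>\<^sup>+y. h (a i * t + y) * f y \<partial>lborel) = (\<integral>\<^sup>+y. h y * (f (y - a i * t) * expd t) \<partial>lborel)"
      by (simp add: nn_integral_cmult[symmetric] ac_simps)
  qed
  also have "\<dots> = (\<integral>\<^sup>+y. \<integral>\<^sup>+t. h y * (f (y - a i * t) * expd t) \<partial>lborel \<partial>lborel)"
    by (rule lborel_pair.Fubini') measurable
  also have "\<dots> = (\<integral>\<^sup>+y. h y * expconv (a i) f y \<partial>lborel)"
    by (intro nn_integral_cong) (simp add: expconv_def nn_integral_cmult)
  finally show "(\<integral>\<^sup>+x. h (\<Sum>j\<in>insert i J. a j * x j) * (\<Prod>j\<in>insert i J. expd (x j)) \<partial>(\<Pi>\<^sub>M j\<in>insert i J. lborel))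
    = (\<integral>\<^sup>+y. h y * expconv (a i) f y \<partial>lborel)" .
qed

definition scaled_expd :: "real \<Rightarrow> real \<Rightarrow> ennreal" where
  "scaled_expd b y = ennreal (1 / \<bar>b\<bar>) * expd (y / b)"

lemma borel_measurable_scaled_expd[measurable]: "scaled_expd b \<in> borel_measurable borel"
  by (auto simp: scaled_expd_def[abs_def])

lemma sum_density_singleton:
  assumes "a i \<noteq> 0"
  shows "sum_density {i} a (scaled_expd (a i))"
  unfolding sum_density_def
proof (intro conjI ballI)
  fix h :: "real \<Rightarrow> ennreal" assume [measurable]: "h \<in> borel_measurable borel"
  have "(\<integral>\<^sup>+x. h (\<Sum>j\<in>{i}. a j * x j) * (\<Prod>j\<in>{i}. expd (x j)) \<partial>(\<Pi>\<^sub>M j\<in>{i}. lborel))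
    = (\<integral>\<^sup>+t. h (a i * t) * expd t \<partial>lborel)"
    using lborel_PiM.product_nn_integral_singleton[of "\<lambda>t. h (a i * t) * expd t" i] by simp
  also have "\<dots> = \<bar>a i\<bar> * (\<integral>\<^sup>+t. ennreal (1 / \<bar>a i\<bar>) * (h (0 + a i * t) * expd t) \<partial>lborel)"
    using assms by (subst nn_integral_cmult) (auto simp: mult.assoc[symmetric] ennreal_mult[symmetric])
  also have "\<dots> = (\<integral>\<^sup>+y. h y * scaled_expd (a i) y \<partial>lborel)"
    using assms
    by (subst nn_integral_real_affine[of "\<lambda>y. h y * scaled_expd (a i) y" "a i" 0])
      (auto simp: scaled_expd_def ac_simps)
  finally show "(\<integral>\<^sup>+x. h (\<Sum>j\<in>{i}. a j * x j) * (\<Prod>j\<in>{i}. expd (x j)) \<partial>(\<Pi>\<^sub>M j\<in>{i}. lborel))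
    = (\<integral>\<^sup>+y. h y * scaled_expd (a i) y \<partial>lborel)" .
qed simp

lemma logconc_scaled_expd:
  assumes "b \<noteq> 0"
  shows "logconc (scaled_expd b)"
proof -
  have lc: "logconc (\<lambda>y. ennreal (1 / \<bar>b\<bar> * exp ((- (1 / b)) * y)))"
    by (rule logconc_exp) simp
  show ?thesis
  proof (cases "0 < b")
    case True
    then have "scaled_expd b = (\<lambda>y. ennreal (1 / \<bar>b\<bar> * exp ((- (1 / b)) * y)) * indicator {0..} y)"
      by (auto simp: scaled_expd_def expd_def fun_eq_iff ennreal_mult[symmetric] zero_le_divide_iff split: split_indicator)
    then show ?thesis
      using logconc_mult[OF lc logconc_indicator_Ici] by (simp only:)
  next
    case False
    then have "scaled_expd b = (\<lambda>y. ennreal (1 / \<bar>b\<bar> * exp ((- (1 / b)) * y)) * indicator {0..} (- y))"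
      using assms
      by (auto simp: scaled_expd_def expd_def fun_eq_iff ennreal_mult[symmetric] zero_le_divide_iff split: split_indicator)
    then show ?thesis
      using logconc_mult[OF lc logconc_reflect[OF logconc_indicator_Ici]] by (simp only:)
  qed
qed

text \<open>The induction starts at a nonzero coefficient, since an empty sum or a sum with zero
  coefficients only is a point mass without density.\<close>

lemma ex_logconc_sum_density:
  assumes "finite J" "i \<in> J" "a i \<noteq> 0"
  shows "\<exists>f. sum_density J a f \<and> logconc f"
proof -
  have "\<exists>f. sum_density (insert i K) a f \<and> logconc f" if "finite K" "i \<notin> K" for K
    using that
  proof (induction K rule: finite_induct)
    case empty
    show ?case using sum_density_singleton[of a i] logconc_scaled_expd[of "a i"] assms(3) by auto
  next
    case (insert j K)
    then obtain f where f: "sum_density (insert i K) a f" "logconc f" by auto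
    have "sum_density (insert j (insert i K)) a (expconv (a j) f)"
      using insert f by (intro sum_density_insert) auto
    moreover have "logconc (expconv (a j) f)"
      using f by (intro logconc_expconv) (auto dest: sum_density_measurable)
    ultimately show ?case by (metis insert_commute)
  qed
  from this[of "J - {i}"] assms show ?thesis by (simp add: insert_absorb)
qed

lemma sum_density_insert_zeros:
  assumes "finite K" "finite J" "J \<inter> K = {}" "\<And>j. j \<in> K \<Longrightarrow> a j = 0" "sum_density J a f"
  shows "sum_density (J \<union> K) a f"
  using assms
proof (induction K rule: finite_induct)
  case (insert k K)
  have "sum_density (insert k (J \<union> K)) a (expconv (a k) f)"
    using insert by (intro sum_density_insert) auto
  with insert.prems show ?case
    by (simp add: expconv_0 sum_density_measurable)
qed simp

text \<open>The positive half of the two-sided exponential density of the equality case; its right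
  limit at 0 is \<open>1 / (b - c)\<close>.\<close>

lemma expconv_scaled_expd:
  assumes "0 < b" "c < 0" "0 < y"
  shows "expconv c (scaled_expd b) y = ennreal (exp (- y / b) / (b - c))"
proof -
  \<comment> \<open>The rate of decay in \<open>t\<close>: the joint exponent is
    \<open>(y - c * t) / b + t = y / b + l * t\<close>.\<close>
  define l where "l = (b - c) / b"
  have l: "0 < l" using assms by (auto simp: l_def)
  have "expconv c (scaled_expd b) y = (\<integral>\<^sup>+t. ennreal (exp (- y / b) / b) * expd (l * t) \<partial>lborel)"
    unfolding expconv_def
  proof (intro nn_integral_cong)
    fix t
    show "scaled_expd b (y - c * t) * expd t = ennreal (exp (- y / b) / b) * expd (l * t)"
    proof (cases "0 \<le> t")
      case True
      then have "0 \<le> (y - c * t) / b"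
        using assms by (intro divide_nonneg_pos) (auto simp: mult_nonpos_nonneg order.trans[of _ 0] )
      moreover have "exp (- ((y - c * t) / b)) * exp (- t) = exp (- y / b) * exp (- (l * t))"
        using assms by (simp add: exp_add[symmetric] l_def field_simps)
      ultimately show ?thesis
        using True assms l
        by (simp add: scaled_expd_def expd_def ennreal_mult[symmetric] mult.assoc divide_inverse ac_simps)
    next
      case False
      then have "l * t < 0" using l by (auto simp: mult_pos_neg)
      then show ?thesis using False by (auto simp: expd_def)
    qed
  qed
  also have "\<dots> = ennreal (exp (- y / b) / b) * (\<integral>\<^sup>+t. expd (l * t) \<partial>lborel)"
    by (simp add: nn_integral_cmult)
  also have "(\<integral>\<^sup>+t. expd (l * t) \<partial>lborel) = ennreal (1 / l)"
  proof -
    have "1 = ennreal l * (\<integral>\<^sup>+t. expd (l * t) \<partial>lborel)"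
      using nn_integral_real_affine[of expd l 0] l by (simp add: nn_integral_expd)
    then have "ennreal (1 / l) * 1 = ennreal (1 / l) * (ennreal l * (\<integral>\<^sup>+t. expd (l * t) \<partial>lborel))" by simp
    then show ?thesis using l by (simp add: mult.assoc[symmetric] ennreal_mult[symmetric])
  qed
  also have "ennreal (exp (- y / b) / b) * ennreal (1 / l) = ennreal (exp (- y / b) / (b - c))"
    using assms l by (simp add: ennreal_mult[symmetric] l_def)
  finally show ?thesis .
qed

lemma sum_density_two:
  assumes "finite J" "i \<in> J" "j \<in> J" "i \<noteq> j" "a i > 0" "a j < 0"
    and "\<And>k. k \<in> J \<Longrightarrow> k \<noteq> i \<Longrightarrow> k \<noteq> j \<Longrightarrow> a k = 0"
  shows "sum_density J a (expconv (a j) (scaled_expd (a i)))"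
proof -
  have "sum_density {j, i} a (expconv (a j) (scaled_expd (a i)))"
    using assms by (intro sum_density_insert sum_density_singleton) auto
  then have "sum_density ({j, i} \<union> (J - {i, j})) a (expconv (a j) (scaled_expd (a i)))"
    using assms by (intro sum_density_insert_zeros) auto
  also have "{j, i} \<union> (J - {i, j}) = J" using assms by auto
  finally show ?thesis .
qed

lemma nn_integral_reflect:
  assumes [measurable]: "f \<in> borel_measurable borel"
  shows "(\<integral>\<^sup>+y. f (- y) \<partial>lborel) = (\<integral>\<^sup>+y. f y \<partial>(lborel :: real measure))"
  using nn_integral_real_affine[of f "- 1" 0] by simp

lemma sum_density_reflect:
  assumes f: "sum_density J a f"
  shows "sum_density J (\<lambda>j. - a j) (\<lambda>y. f (- y))"
  unfolding sum_density_def
proof (intro conjI ballI)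
  note [measurable] = sum_density_measurable[OF f]
  show "(\<lambda>y. f (- y)) \<in> borel_measurable borel" by simp
  fix h :: "real \<Rightarrow> ennreal" assume [measurable]: "h \<in> borel_measurable borel"
  have "(\<integral>\<^sup>+x. h (\<Sum>j\<in>J. - a j * x j) * (\<Prod>j\<in>J. expd (x j)) \<partial>(\<Pi>\<^sub>M j\<in>J. lborel))
    = (\<integral>\<^sup>+y. h (- y) * f y \<partial>lborel)"
    using sum_densityD[OF f, of "\<lambda>y. h (- y)"] by (simp add: sum_negf)
  also have "\<dots> = (\<integral>\<^sup>+y. h y * f (- y) \<partial>lborel)"
    using nn_integral_reflect[of "\<lambda>y. h y * f (- y)"] by simp
  finally show "(\<integral>\<^sup>+x. h (\<Sum>j\<in>J. - a j * x j) * (\<Prod>j\<in>J. expd (x j)) \<partial>(\<Pi>\<^sub>M j\<in>J. lborel)) = (\<integral>\<^sup>+y. h y * f (- y) \<partial>lborel)" .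
qed

section \<open>Moments\<close>

text \<open>A real-valued copy of \<open>expd\<close>: the mean is a signed quantity, so moments are
  computed with the Bochner integral.\<close>

definition rexpd :: "real \<Rightarrow> real" where
  "rexpd t = exp (- t) * indicator {0..} t"

lemma rexpd_nonneg[simp]: "0 \<le> rexpd t"
  by (simp add: rexpd_def)

lemma borel_measurable_rexpd[measurable]: "rexpd \<in> borel_measurable borel"
  by (auto simp: rexpd_def[abs_def])

lemma expd_eq_rexpd: "expd t = ennreal (rexpd t)"
  by (simp add: expd_def rexpd_def split: split_indicator)

lemma has_bochner_integral_rexpd_power:
  "has_bochner_integral lborel (\<lambda>t. rexpd t * t ^ k) (fact k)"
proof (rule has_bochner_integral_nn_integral)
  show "AE t in lborel. 0 \<le> rexpd t * t ^ k"
    by (auto simp: rexpd_def split: split_indicator)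
  have "(\<integral>\<^sup>+t. ennreal (rexpd t * t ^ k) \<partial>lborel) = (\<integral>\<^sup>+t. ennreal (t ^ k * exp (- t)) * indicator {0..} t \<partial>lborel)"
    by (intro nn_integral_cong) (auto simp: rexpd_def mult.commute split: split_indicator)
  then show "(\<integral>\<^sup>+t. ennreal (rexpd t * t ^ k) \<partial>lborel) = ennreal (fact k)"
    by (simp add: nn_intergal_power_times_exp_Ici)
qed auto

lemma has_bochner_integral_prod_rexpd_power:
  assumes "finite J"
  shows "has_bochner_integral (\<Pi>\<^sub>M j\<in>J. lborel) (\<lambda>x. \<Prod>j\<in>J. rexpd (x j) * x j ^ e j) (\<Prod>j\<in>J. fact (e j))"
proof -
  have "integral\<^sup>L lborel (\<lambda>t. rexpd t * t ^ k) = fact k" "integrable lborel (\<lambda>t. rexpd t * t ^ k)" for k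
    using has_bochner_integral_rexpd_power[of k] by (auto simp: has_bochner_integral_iff)
  then show ?thesis
    using lborel_PiM.product_integral_prod[OF assms, of "\<lambda>j t. rexpd t * t ^ e j"]
      lborel_PiM.product_integrable_prod[OF assms, of "\<lambda>j t. rexpd t * t ^ e j"]
    by (simp add: has_bochner_integral_iff)
qed

lemma has_bochner_integral_first_moment:
  assumes J: "finite J"
  shows "has_bochner_integral (\<Pi>\<^sub>M j\<in>J. lborel) (\<lambda>x. (\<Sum>j\<in>J. a j * x j) * (\<Prod>j\<in>J. rexpd (x j))) (\<Sum>j\<in>J. a j)"
proof -
  have "has_bochner_integral (\<Pi>\<^sub>M j\<in>J. lborel) (\<lambda>x. x i * (\<Prod>j\<in>J. rexpd (x j))) 1" if i: "i \<in> J" for i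
    using has_bochner_integral_prod_rexpd_power[OF J, of "\<lambda>j. of_bool (j = i)"] J i
    by (simp add: prod.distrib of_bool_def prod.delta if_distrib[of "\<lambda>k. _ ^ k"] if_distrib[of fact]
        mult.commute cong: if_cong)
  then have "has_bochner_integral (\<Pi>\<^sub>M j\<in>J. lborel)
      (\<lambda>x. \<Sum>i\<in>J. a i * (x i * (\<Prod>j\<in>J. rexpd (x j)))) (\<Sum>i\<in>J. a i * 1)"
    by (intro has_bochner_integral_sum has_bochner_integral_mult_right) auto
  then show ?thesis
    by (simp add: sum_distrib_right mult.assoc)
qed

text \<open>For independent standard exponentials the mixed moment of \<open>E i\<close> and
  \<open>E k\<close> is 1, and 2 if \<open>i = k\<close>; the diagonal excess contributes the sum of
  squares.\<close>

lemma has_bochner_integral_second_moment: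
  assumes J: "finite J"
  shows "has_bochner_integral (\<Pi>\<^sub>M j\<in>J. lborel) (\<lambda>x. (\<Sum>j\<in>J. a j * x j)\<^sup>2 * (\<Prod>j\<in>J. rexpd (x j)))
    ((\<Sum>j\<in>J. a j)\<^sup>2 + (\<Sum>j\<in>J. (a j)\<^sup>2))"
proof -
  have G: "has_bochner_integral (\<Pi>\<^sub>M j\<in>J. lborel) (\<lambda>x. x i * x k * (\<Prod>j\<in>J. rexpd (x j))) (1 + of_bool (k = i))"
    if i: "i \<in> J" and k: "k \<in> J" for i k
  proof -
    have "(\<Prod>j\<in>J. fact (of_bool (j = i) + of_bool (j = k))) = (1 + of_bool (k = i) :: real)"
    proof (cases "i = k")
      case True
      then have "(\<Prod>j\<in>J. fact (of_bool (j = i) + of_bool (j = k))) = (\<Prod>j\<in>J. if j = i then 2 else 1 :: real)"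
        by (intro prod.cong) auto
      then show ?thesis using True J i by simp
    next
      case False
      then have "(\<Prod>j\<in>J. fact (of_bool (j = i) + of_bool (j = k))) = (\<Prod>j\<in>J. 1 :: real)"
        by (intro prod.cong) auto
      then show ?thesis using False by simp
    qed
    moreover have "(\<Prod>j\<in>J. rexpd (x j) * x j ^ (of_bool (j = i) + of_bool (j = k))) = x i * x k * (\<Prod>j\<in>J. rexpd (x j))" for x
      using J i k
      by (simp add: power_add prod.distrib of_bool_def prod.delta if_distrib[of "\<lambda>k. _ ^ k"] cong: if_cong)
    ultimately show ?thesis
      using has_bochner_integral_prod_rexpd_power[OF J, of "\<lambda>j. of_bool (j = i) + of_bool (j = k)"]
      by simp
  qed
  then have "has_bochner_integral (\<Pi>\<^sub>M j\<in>J. lborel)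
      (\<lambda>x. \<Sum>i\<in>J. \<Sum>k\<in>J. a i * a k * (x i * x k * (\<Prod>j\<in>J. rexpd (x j))))
      (\<Sum>i\<in>J. \<Sum>k\<in>J. a i * a k * (1 + of_bool (k = i)))"
    by (intro has_bochner_integral_sum has_bochner_integral_mult_right) auto
  moreover have "(\<Sum>i\<in>J. \<Sum>k\<in>J. a i * a k * (1 + of_bool (k = i))) = (\<Sum>j\<in>J. a j)\<^sup>2 + (\<Sum>j\<in>J. (a j)\<^sup>2)"
    using J by (simp add: distrib_left sum.distrib power2_eq_square sum_product)
  moreover have "(\<Sum>i\<in>J. \<Sum>k\<in>J. a i * a k * (x i * x k * r)) = (\<Sum>j\<in>J. a j * x j)\<^sup>2 * r" for x :: "'a \<Rightarrow> real" and r
    unfolding power2_eq_square sum_product unfolding sum_distrib_right by (simp add: ac_simps)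
  ultimately show ?thesis by simp
qed

lemma sum_density_total:
  assumes "finite J" "sum_density J a f"
  shows "(\<integral>\<^sup>+y. f y \<partial>lborel) = 1"
proof -
  have "(\<integral>\<^sup>+y. f y \<partial>lborel) = (\<integral>\<^sup>+x. (\<Prod>j\<in>J. expd (x j)) \<partial>(\<Pi>\<^sub>M j\<in>J. lborel))"
    using sum_densityD[OF assms(2), of "\<lambda>_. 1"] by simp
  also have "\<dots> = 1"
    using assms(1) by (subst lborel_PiM.product_nn_integral_prod) (auto simp: nn_integral_expd)
  finally show ?thesis .
qed

text \<open>The two closed rays overlap only in the null set \<open>{0}\<close>.\<close>

lemma tail_0_add_reflect:
  assumes [measurable]: "f \<in> borel_measurable borel"
  shows "tail f 0 + tail (\<lambda>y. f (- y)) 0 = (\<integral>\<^sup>+y. f y \<partial>lborel)"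
proof -
  have "tail (\<lambda>y. f (- y)) 0 = (\<integral>\<^sup>+y. f y * indicator {..0} y \<partial>lborel)"
    unfolding tail_def
    by (subst nn_integral_reflect[symmetric]) (auto intro!: nn_integral_cong split: split_indicator)
  then have "tail f 0 + tail (\<lambda>y. f (- y)) 0 = (\<integral>\<^sup>+y. f y * indicator {0..} y + f y * indicator {..0} y \<partial>lborel)"
    by (simp add: tail_def nn_integral_add)
  also have "\<dots> = (\<integral>\<^sup>+y. f y \<partial>lborel)"
    using AE_lborel_singleton[of 0]
    by (intro nn_integral_cong_AE) (auto elim!: eventually_mono split: split_indicator)
  finally show ?thesis .
qed

lemma sum_density_half_moment:
  assumes J: "finite J" and f: "sum_density J a f" 
    and [measurable]: "h \<in> borel_measurable borel" and h: "\<And>y. 0 \<le> h y"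
    and int: "integrable (\<Pi>\<^sub>M j\<in>J. lborel) (\<lambda>x. h (\<Sum>j\<in>J. a j * x j) * (\<Prod>j\<in>J. rexpd (x j)))"
  shows "(\<integral>\<^sup>+y. f y * ennreal (h y) \<partial>lborel)
    = ennreal (\<integral>x. h (\<Sum>j\<in>J. a j * x j) * (\<Prod>j\<in>J. rexpd (x j)) \<partial>(\<Pi>\<^sub>M j\<in>J. lborel))"
proof -
  have "(\<integral>\<^sup>+y. f y * ennreal (h y) \<partial>lborel)
    = (\<integral>\<^sup>+x. ennreal (h (\<Sum>j\<in>J. a j * x j)) * (\<Prod>j\<in>J. expd (x j)) \<partial>(\<Pi>\<^sub>M j\<in>J. lborel))"
    using sum_densityD[OF f, of "\<lambda>y. ennreal (h y)"] by (simp add: mult.commute)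
  also have "\<dots> = (\<integral>\<^sup>+x. ennreal (h (\<Sum>j\<in>J. a j * x j) * (\<Prod>j\<in>J. rexpd (x j))) \<partial>(\<Pi>\<^sub>M j\<in>J. lborel))"
    by (simp add: expd_eq_rexpd prod_ennreal ennreal_mult h prod_nonneg)
  also have "\<dots> = ennreal (\<integral>x. h (\<Sum>j\<in>J. a j * x j) * (\<Prod>j\<in>J. rexpd (x j)) \<partial>(\<Pi>\<^sub>M j\<in>J. lborel))"
    using int by (rule nn_integral_eq_integral) (simp add: h prod_nonneg)
  finally show ?thesis .
qed

text \<open>The passage from extended nonnegative tails to real numbers, on which the final
  inequality can be proved by algebra. The reflected density carries the moments of the negative
  part.\<close>

lemma sum_density_half_moments:
  assumes J: "finite J" and f: "sum_density J a f"
  obtains p q m1 m2 s1 s2 :: real where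
    "0 \<le> p" "0 \<le> q" "0 \<le> m1" "0 \<le> m2" "0 \<le> s1" "0 \<le> s2"
    "p + q = 1" "m1 - m2 = (\<Sum>j\<in>J. a j)" "s1 + s2 = ((\<Sum>j\<in>J. a j)\<^sup>2 + (\<Sum>j\<in>J. (a j)\<^sup>2)) / 2"
    "tail f 0 = ennreal p" "tail (tail f) 0 = ennreal m1" "tail (tail (tail f)) 0 = ennreal s1"
    "tail (\<lambda>y. f (- y)) 0 = ennreal q" "tail (tail (\<lambda>y. f (- y))) 0 = ennreal m2"
    "tail (tail (tail (\<lambda>y. f (- y)))) 0 = ennreal s2"
proof -
  note [measurable] = sum_density_measurable[OF f]
  define S where "S x = (\<Sum>j\<in>J. a j * x j)" for x
  define R where "R x = (\<Prod>j\<in>J. rexpd (x j))" for x :: "_ \<Rightarrow> real"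
  have R: "0 \<le> R x" for x by (simp add: R_def prod_nonneg)
  have [measurable]: "S \<in> borel_measurable (\<Pi>\<^sub>M j\<in>J. lborel)" "R \<in> borel_measurable (\<Pi>\<^sub>M j\<in>J. lborel)"
    by (auto simp: S_def[abs_def] R_def[abs_def])
  let ?P = "\<Pi>\<^sub>M j\<in>J. lborel :: real measure"
  have 1: "integrable ?P (\<lambda>x. S x * R x)" "(\<integral>x. S x * R x \<partial>?P) = (\<Sum>j\<in>J. a j)"
    using has_bochner_integral_first_moment[OF J, of a] by (auto simp: has_bochner_integral_iff S_def R_def)
  have 2: "integrable ?P (\<lambda>x. (S x)\<^sup>2 * R x)" "(\<integral>x. (S x)\<^sup>2 * R x \<partial>?P) = (\<Sum>j\<in>J. a j)\<^sup>2 + (\<Sum>j\<in>J. (a j)\<^sup>2)"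
    using has_bochner_integral_second_moment[OF J, of a] by (auto simp: has_bochner_integral_iff S_def R_def)
  have m1: "integrable ?P (\<lambda>x. max 0 (S x) * R x)" and m2: "integrable ?P (\<lambda>x. max 0 (- S x) * R x)"
    by (rule Bochner_Integration.integrable_bound[OF 1(1)]; auto simp: abs_mult intro!: mult_right_mono)+
  have s1: "integrable ?P (\<lambda>x. (max 0 (S x))\<^sup>2 / 2 * R x)" and s2: "integrable ?P (\<lambda>x. (max 0 (- S x))\<^sup>2 / 2 * R x)"
    by (rule Bochner_Integration.integrable_bound[OF 2(1)]; auto simp: abs_mult max_def intro!: mult_right_mono)+
  have refl: "(\<integral>\<^sup>+y. f (- y) * ennreal (h y) \<partial>lborel) = (\<integral>\<^sup>+y. f y * ennreal (h (- y)) \<partial>lborel)"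
    if [measurable]: "h \<in> borel_measurable borel" for h
    using nn_integral_reflect[of "\<lambda>y. f y * ennreal (h (- y))"] by simp
  have "tail f 0 + tail (\<lambda>y. f (- y)) 0 = 1"
    using tail_0_add_reflect[of f] sum_density_total[OF J f] by simp
  then obtain p q where pq: "0 \<le> p" "0 \<le> q" "tail f 0 = ennreal p" "tail (\<lambda>y. f (- y)) 0 = ennreal q"
    by (cases "tail f 0"; cases "tail (\<lambda>y. f (- y)) 0") auto
  with \<open>tail f 0 + _ = 1\<close> have "p + q = 1" by (simp add: ennreal_plus[symmetric] del: ennreal_plus)
  show ?thesis
  proof (rule that[OF pq(1,2) _ _ _ _ \<open>p + q = 1\<close> _ _ pq(3) _ _ pq(4)])
    show "tail (tail f) 0 = ennreal (\<integral>x. max 0 (S x) * R x \<partial>?P)"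
      using sum_density_half_moment[OF J f, of "\<lambda>y. max 0 y"] m1 by (simp add: tail_tail_eq S_def R_def)
    show "tail (tail (\<lambda>y. f (- y))) 0 = ennreal (\<integral>x. max 0 (- S x) * R x \<partial>?P)"
      using sum_density_half_moment[OF J f, of "\<lambda>y. max 0 (- y)"] m2 by (simp add: tail_tail_eq refl S_def R_def)
    show "tail (tail (tail f)) 0 = ennreal (\<integral>x. (max 0 (S x))\<^sup>2 / 2 * R x \<partial>?P)"
      using sum_density_half_moment[OF J f, of "\<lambda>y. (max 0 y)\<^sup>2 / 2"] s1 by (simp add: tail_tail_tail_eq S_def R_def)
    show "tail (tail (tail (\<lambda>y. f (- y)))) 0 = ennreal (\<integral>x. (max 0 (- S x))\<^sup>2 / 2 * R x \<partial>?P)"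
      using sum_density_half_moment[OF J f, of "\<lambda>y. (max 0 (- y))\<^sup>2 / 2"] s2 by (simp add: tail_tail_tail_eq refl S_def R_def)
    show "(\<integral>x. max 0 (S x) * R x \<partial>?P) - (\<integral>x. max 0 (- S x) * R x \<partial>?P) = (\<Sum>j\<in>J. a j)"
      unfolding 1(2)[symmetric] Bochner_Integration.integral_diff[OF m1 m2, symmetric]
      by (intro Bochner_Integration.integral_cong) (auto simp: max_def)
    show "(\<integral>x. (max 0 (S x))\<^sup>2 / 2 * R x \<partial>?P) + (\<integral>x. (max 0 (- S x))\<^sup>2 / 2 * R x \<partial>?P)
      = ((\<Sum>j\<in>J. a j)\<^sup>2 + (\<Sum>j\<in>J. (a j)\<^sup>2)) / 2"
      unfolding 2(2)[symmetric] Bochner_Integration.integral_add[OF s1 s2, symmetric]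
        integral_divide_zero[symmetric]
      by (intro Bochner_Integration.integral_cong) (auto simp: max_def field_simps)
  qed (auto intro!: integral_nonneg_AE AE_I2 mult_nonneg_nonneg R)
qed

section \<open>The inequality between half moments\<close>

lemma tail_eq_0:
  assumes "\<And>y. x \<le> y \<Longrightarrow> f y = 0"
  shows "tail f x = 0"
proof -
  have "tail f x = (\<integral>\<^sup>+y. 0 \<partial>(lborel :: real measure))"
    unfolding tail_def using assms by (intro nn_integral_cong) (auto split: split_indicator)
  then show ?thesis by simp
qed

lemma tail_antimono: "x \<le> y \<Longrightarrow> tail f y \<le> tail f x"
  unfolding tail_def by (intro nn_integral_mono) (auto split: split_indicator)

text \<open>For the degenerate case \<open>p = 0\<close>, in which \<open>p * s <= m^2\<close> says
  nothing about \<open>s\<close>.\<close>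

lemma tail_tail_tail_eq_0:
  assumes "tail f x = 0"
  shows "tail (tail (tail f)) x = 0"
proof -
  have 1: "tail f y = 0" if "x \<le> y" for y
    using tail_antimono[OF that, of f] assms by simp
  have "tail (tail f) y = 0" if "x \<le> y" for y
    by (rule tail_eq_0) (use that 1 in auto)
  then show ?thesis by (rule tail_eq_0)
qed

text \<open>Here \<open>k\<close> stands for \<open>t * \<kappa>\<close>. The difference of the two
  sides has the factor \<open>p - q - k\<close> because the two-sided exponential, for which
  \<open>k = p - q\<close>, turns every estimate into an equality.\<close>

lemma moment_bound_aux:
  fixes p q k :: real
  assumes "q \<le> p" "0 \<le> q" "p + q = 1" "\<bar>k\<bar> \<le> p - q"
  shows "(k + q\<^sup>2)\<^sup>2 \<le> p * ((1 + 3 * k\<^sup>2) / 4 - q ^ 3)"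
proof -
  have p: "p = 1 - q" using assms by simp
  have "p * ((1 + 3 * k\<^sup>2) / 4 - q ^ 3) - (k + q\<^sup>2)\<^sup>2
      = (p - q - k) * ((1 + 3 * q) * (k + (p - q)) + 8 * q\<^sup>2) / 4"
    unfolding p by (simp add: field_simps power2_eq_square power3_eq_cube)
  also have "\<dots> \<ge> 0"
  proof -
    have "0 \<le> p - q - k" "0 \<le> (1 + 3 * q) * (k + (p - q))"
      using assms by (auto intro!: mult_nonneg_nonneg)
    then show ?thesis by simp
  qed
  finally show ?thesis by simp
qed

text \<open>
  Here \<open>t\<close> is the density at 0, and \<open>p\<close>, \<open>m1\<close>, \<open>2 * s1\<close> are the moments of order 0, 1, 2 of the positive
  part (\<open>q\<close>, \<open>m2\<close>, \<open>2 * s2\<close> of the negative part). Assuming the contrary, \<open>t\<^sup>2 s \<le> p\<^sup>3\<close> on both sides forces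
  \<open>\<bar>t * \<kappa>\<bar> < p - q\<close> if \<open>q \<le> p\<close>, and this contradicts the preceding lemma.
\<close>

lemma half_moments_bound:
  fixes t p q m1 m2 s1 s2 \<kappa> :: real
  assumes nonneg: "0 \<le> t" "0 \<le> p" "0 \<le> q" "0 \<le> m1" "0 \<le> m2" "0 \<le> s1" "0 \<le> s2"
    and pq: "p + q = 1" and m: "m1 - m2 = \<kappa>" and s: "s1 + s2 = (\<kappa>\<^sup>2 + 1) / 2"
    and tm: "t * m1 \<le> p\<^sup>2" "t * m2 \<le> q\<^sup>2" and ps: "p * s1 \<le> m1\<^sup>2" "q * s2 \<le> m2\<^sup>2"
    and s0: "p = 0 \<Longrightarrow> s1 = 0" "q = 0 \<Longrightarrow> s2 = 0"
  shows "t\<^sup>2 * (2 - \<kappa>\<^sup>2) \<le> 1"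
proof -
  \<comment> \<open>Eliminates \<open>m\<close> from \<open>t * m <= p^2\<close> and
    \<open>p * s <= m^2\<close>; the division by \<open>p\<close> is what needs the separate case
    \<open>p = 0\<close>.\<close>
  have cube: "t\<^sup>2 * s \<le> p ^ 3"
    if "0 \<le> p" "0 \<le> m" "t * m \<le> p\<^sup>2" "p * s \<le> m\<^sup>2" "p = 0 \<Longrightarrow> s = 0" for p m s
  proof (cases "p = 0")
    case False
    have "p * (t\<^sup>2 * s) \<le> t\<^sup>2 * m\<^sup>2"
      using mult_left_mono[OF that(4), of "t\<^sup>2"] by (simp add: ac_simps)
    also have "\<dots> \<le> (p\<^sup>2)\<^sup>2"
      unfolding power_mult_distrib[symmetric] using that nonneg by (intro power_mono) auto
    also have "\<dots> = p * p ^ 3" by (simp add: power2_eq_square power3_eq_cube)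
    finally show ?thesis using False that by simp
  qed (use that in auto)
  \<comment> \<open>Exchanging positive and negative parts replaces \<open>\<kappa>\<close> by
    \<open>- \<kappa>\<close> and keeps the claim, so \<open>q <= p\<close> may be assumed.\<close>
  have main: "t\<^sup>2 * (2 - \<kappa>\<^sup>2) \<le> 1"
    if nonneg: "0 \<le> p" "0 \<le> q" "0 \<le> m1" "0 \<le> m2"
      and pq: "p + q = 1" and m: "m1 - m2 = \<kappa>" and s: "s1 + s2 = (\<kappa>\<^sup>2 + 1) / 2"
      and tm: "t * m1 \<le> p\<^sup>2" "t * m2 \<le> q\<^sup>2" and ps: "p * s1 \<le> m1\<^sup>2" "q * s2 \<le> m2\<^sup>2"
      and s0: "p = 0 \<Longrightarrow> s1 = 0" "q = 0 \<Longrightarrow> s2 = 0" and "q \<le> p"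
    for p q m1 m2 s1 s2 \<kappa> :: real
  proof (rule ccontr)
    assume neg: "\<not> t\<^sup>2 * (2 - \<kappa>\<^sup>2) \<le> 1"
    define k where "k = t * \<kappa>"
    \<comment> \<open>The negated claim says \<open>2 * t^2 > 1 + k^2\<close>, while
      \<open>t^2 * (s1 + s2) = (k^2 + t^2) / 2\<close>. The bound is written so as to match
      \<open>p^3 + q^3 = (1 + 3 * (p - q)^2) / 4\<close>.\<close>
    have *: "(1 + 3 * k\<^sup>2) / 4 < t\<^sup>2 * (s1 + s2)"
      using neg unfolding s k_def by (simp add: field_simps)
    also have "\<dots> \<le> p ^ 3 + q ^ 3"
      using cube[of p m1 s1] cube[of q m2 s2] that by (simp add: distrib_left)
    also have "\<dots> = (1 + 3 * (p - q)\<^sup>2) / 4"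
    proof -
      have p: "p = 1 - q" using pq by simp
      show ?thesis unfolding p by (simp add: field_simps power2_eq_square power3_eq_cube)
    qed
    finally have "k\<^sup>2 < (p - q)\<^sup>2" by simp
    then have k: "\<bar>k\<bar> \<le> p - q" using \<open>q \<le> p\<close> abs_le_square_iff[of k "p - q"] by simp
    have "p * ((1 + 3 * k\<^sup>2) / 4 - q ^ 3) < p * (t\<^sup>2 * (s1 + s2) - q ^ 3)"
      using * pq \<open>q \<le> p\<close> nonneg by (intro mult_strict_left_mono) auto
    also have "\<dots> \<le> p * (t\<^sup>2 * s1)"
      using cube[of q m2 s2] that by (intro mult_left_mono) (auto simp: distrib_left)
    also have "\<dots> \<le> (t * m1)\<^sup>2"
      using mult_left_mono[OF ps(1), of "t\<^sup>2"] by (simp add: ac_simps power_mult_distrib)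
    also have "\<dots> \<le> (k + q\<^sup>2)\<^sup>2"
    proof (rule power_mono)
      \<comment> \<open>The mean turns the upper bound on the negative part into one on the positive
        part, sharper here than \<open>t * m1 <= p^2\<close>.\<close>
      have "t * m1 = k + t * m2" unfolding k_def m[symmetric] by (simp add: algebra_simps)
      then show "t * m1 \<le> k + q\<^sup>2" using tm by simp
      show "0 \<le> t * m1" using \<open>0 \<le> t\<close> nonneg by simp
    qed
    finally show False
      using moment_bound_aux[OF \<open>q \<le> p\<close> _ pq k] nonneg by simp
  qed
  show ?thesis
  proof (cases "q \<le> p")
    case True
    then show ?thesis using assms by (intro main[of p q m1 m2 \<kappa> s1 s2]) auto
  next
    case False
    then show ?thesis using assms main[of q p m2 m1 "- \<kappa>" s2 s1] by auto
  qed
qed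

section \<open>Lebesgue measure in orthonormal coordinates\<close>

text \<open>On boxes this is the one-dimensional substitution in each factor, and boxes determine a
  product measure. The restricted abstraction keeps the argument of \<open>F\<close> in the space of
  the product.\<close>

lemma nn_integral_PiM_affine:
  fixes I :: "'i set" and d :: "'i \<Rightarrow> real"
  assumes I: "finite I" and l: "0 < l" and F[measurable]: "F \<in> borel_measurable (\<Pi>\<^sub>M i\<in>I. lborel)"
  shows "(\<integral>\<^sup>+x. F x \<partial>(\<Pi>\<^sub>M i\<in>I. lborel))
    = ennreal (l ^ card I) * (\<integral>\<^sup>+x. F (\<lambda>i\<in>I. d i + l * x i) \<partial>(\<Pi>\<^sub>M i\<in>I. lborel))"
proof -
  let ?M = "\<Pi>\<^sub>M i\<in>I. lborel :: real measure"
  define g where "g x = (\<lambda>i\<in>I. d i + l * x i)" for x :: "'i \<Rightarrow> real"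
  have [measurable]: "g \<in> measurable ?M ?M"
    unfolding g_def by measurable
  have "density (distr ?M ?M g) (\<lambda>_. ennreal (l ^ card I)) = ?M"
  proof (rule lborel_PiM.PiM_eqI[OF I])
    fix A :: "'i \<Rightarrow> real set" assume "\<And>i. i \<in> I \<Longrightarrow> A i \<in> sets lborel"
    then have [measurable]: "i \<in> I \<Longrightarrow> A i \<in> sets borel" for i by simp
    have A: "Pi\<^sub>E I A \<in> sets ?M" using I by (intro sets_PiM_I_finite) auto
    have vim: "g -` Pi\<^sub>E I A \<inter> space ?M = (\<Pi>\<^sub>E i\<in>I. (\<lambda>t. d i + l * t) -` A i)"
      by (auto simp: g_def space_PiM PiE_iff)
    have "emeasure (density (distr ?M ?M g) (\<lambda>_. ennreal (l ^ card I))) (Pi\<^sub>E I A)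
      = ennreal (l ^ card I) * emeasure ?M (\<Pi>\<^sub>E i\<in>I. (\<lambda>t. d i + l * t) -` A i)"
      using A by (subst emeasure_density) (auto simp: nn_integral_cmult_indicator emeasure_distr vim)
    also have "emeasure ?M (\<Pi>\<^sub>E i\<in>I. (\<lambda>t. d i + l * t) -` A i)
      = (\<Prod>i\<in>I. emeasure lborel ((\<lambda>t. d i + l * t) -` A i))"
      using I by (intro lborel_PiM.emeasure_PiM) (auto intro!: measurable_sets_borel[of _ borel])
    also have "ennreal (l ^ card I) * \<dots> = (\<Prod>i\<in>I. ennreal l * emeasure lborel ((\<lambda>t. d i + l * t) -` A i))"
      using I l by (simp add: prod.distrib ennreal_power)
    also have "\<dots> = (\<Prod>i\<in>I. emeasure lborel (A i))"
    proof (rule prod.cong)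
      fix i assume i: "i \<in> I"
      have "emeasure lborel (A i) = (\<integral>\<^sup>+t. indicator (A i) t \<partial>lborel)" using i by simp
      also have "\<dots> = ennreal l * (\<integral>\<^sup>+t. indicator (A i) (d i + l * t) \<partial>lborel)"
        using i l by (subst nn_integral_real_affine[where c = l and t = "d i"]) auto
      also have "(\<lambda>t. indicator (A i) (d i + l * t) :: ennreal) = indicator ((\<lambda>t. d i + l * t) -` A i)"
        by (auto simp: fun_eq_iff split: split_indicator)
      also have "(\<integral>\<^sup>+t. indicator ((\<lambda>t. d i + l * t) -` A i) t \<partial>lborel) = emeasure lborel ((\<lambda>t. d i + l * t) -` A i)"
        using i by (intro nn_integral_indicator) (auto intro!: measurable_sets_borel[of _ borel])
      finally show "ennreal l * emeasure lborel ((\<lambda>t. d i + l * t) -` A i) = emeasure lborel (A i)" ..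
    qed simp
    finally show "emeasure (density (distr ?M ?M g) (\<lambda>_. ennreal (l ^ card I))) (Pi\<^sub>E I A) = (\<Prod>i\<in>I. emeasure lborel (A i))" .
  qed simp
  then have "(\<integral>\<^sup>+x. F x \<partial>?M) = (\<integral>\<^sup>+x. F x \<partial>density (distr ?M ?M g) (\<lambda>_. ennreal (l ^ card I)))" by simp
  also have "\<dots> = ennreal (l ^ card I) * (\<integral>\<^sup>+x. F (g x) \<partial>?M)"
    by (subst nn_integral_density) (auto simp: nn_integral_cmult nn_integral_distr)
  finally show ?thesis by (simp add: g_def)
qed

text \<open>The bridge between product measures and \<open>lborel\<close> on vectors. The
  enumeration \<open>e\<close> is free, since both numbered frames and the index type itself serve
  as \<open>I\<close>.\<close>

lemma distr_PiM_axis: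
  fixes e :: "'i \<Rightarrow> 'm::finite"
  assumes I: "finite I" and e: "bij_betw e I UNIV"
  shows "distr (\<Pi>\<^sub>M i\<in>I. lborel) borel (\<lambda>c. \<Sum>i\<in>I. c i *\<^sub>R axis (e i) (1::real)) = lborel"
proof (rule lborel_eqI[symmetric])
  let ?M = "\<Pi>\<^sub>M i\<in>I. lborel :: real measure"
  let ?g = "\<lambda>c. \<Sum>i\<in>I. c i *\<^sub>R axis (e i) (1::real)"
  have comp: "?g c $ e i = c i" if "i \<in> I" for c i
  proof -
    have "?g c $ e i = (\<Sum>j\<in>I. if j = i then c j else 0)"
      using e that unfolding sum_component
      by (intro sum.cong) (auto simp: axis_def bij_betw_def inj_on_def)
    then show ?thesis using I that by simp
  qed
  fix l u :: "real^'m" assume le: "\<And>b. b \<in> Basis \<Longrightarrow> l \<bullet> b \<le> u \<bullet> b"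
  have le: "l $ j \<le> u $ j" for j
    using le[of "axis j 1"] by (auto simp: inner_axis Basis_vec_def)
  have "?g -` box l u \<inter> space ?M = (\<Pi>\<^sub>E i\<in>I. {l $ e i <..< u $ e i})"
  proof -
    have "?g c \<in> box l u \<longleftrightarrow> (\<forall>i\<in>I. l $ e i < c i \<and> c i < u $ e i)" for c
    proof -
      have "?g c \<in> box l u \<longleftrightarrow> (\<forall>j\<in>e ` I. l $ j < ?g c $ j \<and> ?g c $ j < u $ j)"
        using e by (simp add: mem_box_cart bij_betw_def)
      then show ?thesis using comp by auto
    qed
    then show ?thesis by (auto simp: space_PiM PiE_iff)
  qed
  then have "emeasure (distr ?M borel ?g) (box l u) = emeasure ?M (\<Pi>\<^sub>E i\<in>I. {l $ e i <..< u $ e i})"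
    by (subst emeasure_distr) auto
  also have "\<dots> = (\<Prod>i\<in>I. ennreal (u $ e i - l $ e i))"
    using I le by (subst lborel_PiM.emeasure_PiM) auto
  also have "\<dots> = (\<Prod>j\<in>UNIV. ennreal (u $ j - l $ j))"
    using e by (rule prod.reindex_bij_betw)
  also have "\<dots> = ennreal (\<Prod>j\<in>UNIV. (u - l) $ j)"
    using le by (subst prod_ennreal) auto
  also have "(\<Prod>j\<in>UNIV. (u - l) $ j) = (\<Prod>b\<in>Basis. (u - l) \<bullet> b)"
    by (simp add: Basis_vec_def UNION_singleton_eq_range prod.reindex axis_inverse inj_on_def axis_eq_axis inner_axis)
  finally show "emeasure (distr ?M borel ?g) (box l u) = ennreal (\<Prod>b\<in>Basis. (u - l) \<bullet> b)" .
qed simp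

lemma nn_integral_lborel_translate:
  fixes c :: "'a::euclidean_space"
  assumes [measurable]: "F \<in> borel_measurable borel"
  shows "(\<integral>\<^sup>+x. F (c + x) \<partial>lborel) = (\<integral>\<^sup>+x. F x \<partial>lborel)"
proof -
  have "(\<integral>\<^sup>+x. F x \<partial>lborel) = (\<integral>\<^sup>+x. F x \<partial>distr lborel borel ((+) c))"
    by (simp add: lborel_distr_plus)
  then show ?thesis by (simp add: nn_integral_distr)
qed

text \<open>
  The library has this only for index types of class \<open>wellorder\<close>. Here both sides, multiplied by
  the volume of the unit ball \<open>B\<close>, equal \<open>\<integral>\<integral> 1\<^sub>B(x) 1\<^sub>E(f u + x) dx du\<close>.
\<close>

lemma distr_lborel_orthogonal:
  fixes f :: "'a::euclidean_space \<Rightarrow> 'a"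
  assumes f: "orthogonal_transformation f"
  shows "distr lborel borel f = lborel"
proof (rule measure_eqI)
  fix E assume "E \<in> sets (distr lborel borel f)"
  then have [measurable]: "E \<in> sets borel" by simp
  define B :: "'a set" where "B = ball 0 1"
  have [measurable]: "B \<in> sets borel" by (simp add: B_def)
  have lin: "linear f" using f by (rule orthogonal_transformation_linear)
  have [measurable]: "f \<in> borel_measurable borel"
    using lin by (intro borel_measurable_continuous_onI linear_continuous_on) (simp add: linear_linear)
  have surj: "\<exists>v. x = f v" for x
    using orthogonal_transformation_surj[OF f] by auto
  have mE: "emeasure (distr lborel borel f) E = (\<integral>\<^sup>+u. indicator E (f u) \<partial>lborel)"
    using nn_integral_distr[of f lborel borel "indicator E"] by simp
  have "emeasure lborel B * emeasure (distr lborel borel f) E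
      = (\<integral>\<^sup>+x. indicator B x * (\<integral>\<^sup>+u. indicator E (f u) \<partial>lborel) \<partial>lborel)"
    unfolding mE by (subst nn_integral_multc) auto
  also have "\<dots> = (\<integral>\<^sup>+x. \<integral>\<^sup>+u. indicator B x * indicator E (f u + x) \<partial>lborel \<partial>lborel)"
  proof (intro nn_integral_cong)
    fix x :: 'a
    obtain v where v: "x = f v" using surj by blast
    have "(\<integral>\<^sup>+u. indicator E (f u) \<partial>lborel) = (\<integral>\<^sup>+u. indicator E (f (v + u)) \<partial>lborel)"
      by (rule nn_integral_lborel_translate[of "\<lambda>u. indicator E (f u)", symmetric]) simp
    also have "\<dots> = (\<integral>\<^sup>+u. indicator E (f u + x) \<partial>lborel)"
      by (simp add: v linear_add[OF lin] add.commute)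
    finally show "indicator B x * (\<integral>\<^sup>+u. indicator E (f u) \<partial>lborel)
      = (\<integral>\<^sup>+u. indicator B x * indicator E (f u + x) \<partial>lborel)"
      by (simp add: nn_integral_cmult)
  qed
  also have "\<dots> = (\<integral>\<^sup>+u. \<integral>\<^sup>+x. indicator B x * indicator E (f u + x) \<partial>lborel \<partial>lborel)"
    by (rule lborel_pair.Fubini') measurable
  also have "\<dots> = (\<integral>\<^sup>+u. \<integral>\<^sup>+x. indicator B (x - f u) * indicator E x \<partial>lborel \<partial>lborel)"
  proof (rule nn_integral_cong)
    fix u
    show "(\<integral>\<^sup>+x. indicator B x * indicator E (f u + x) \<partial>lborel)
      = (\<integral>\<^sup>+x. indicator B (x - f u) * indicator E x \<partial>lborel)"
      using nn_integral_lborel_translate[of "\<lambda>x. indicator B (x - f u) * indicator E x" "f u"] by simp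
  qed
  also have "\<dots> = (\<integral>\<^sup>+x. \<integral>\<^sup>+u. indicator B (x - f u) * indicator E x \<partial>lborel \<partial>lborel)"
    by (rule lborel_pair.Fubini') measurable
  also have "\<dots> = (\<integral>\<^sup>+x. emeasure lborel B * indicator E x \<partial>lborel)"
  proof (intro nn_integral_cong)
    fix x :: 'a
    obtain v where v: "x = f v" using surj by blast
    have "indicator B (x - f u) = (indicator (ball v 1) u :: ennreal)" for u
      using f by (simp add: B_def v linear_diff[OF lin, symmetric] orthogonal_transformation_norm dist_norm indicator_def)
    then have "(\<integral>\<^sup>+u. indicator B (x - f u) \<partial>lborel) = emeasure lborel B"
      by (simp add: B_def emeasure_ball)
    then show "(\<integral>\<^sup>+u. indicator B (x - f u) * indicator E x \<partial>lborel) = emeasure lborel B * indicator E x"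
      by (simp add: nn_integral_multc)
  qed
  also have "\<dots> = emeasure lborel B * emeasure lborel E"
    by (simp add: nn_integral_cmult)
  finally show "emeasure (distr lborel borel f) E = emeasure lborel E"
    using less_imp_neq[OF unit_ball_vol_pos[of "real DIM('a)"]] by (auto simp: B_def emeasure_ball ennreal_mult_cancel_left)
qed simp

text \<open>A full orthonormal frame is the image of the standard basis under an orthogonal map, so
  integration in frame coordinates reduces to orthogonal invariance of
  \<open>lborel\<close>.\<close>

lemma frame_transformation:
  fixes b :: "nat \<Rightarrow> real^'m"
  assumes b: "orthonormal_frame CARD('m) b" and e: "bij_betw e {..<CARD('m)} (UNIV :: 'm set)"
  shows "orthogonal_transformation (\<lambda>x. \<Sum>i<CARD('m). x $ e i *\<^sub>R b i)"
  unfolding orthogonal_transformation_def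
proof (intro conjI allI)
  show "linear (\<lambda>x. \<Sum>i<CARD('m). x $ e i *\<^sub>R b i)"
    by (rule linearI) (auto simp: sum.distrib scaleR_left_distrib scaleR_sum_right)
  fix v w :: "real^'m"
  have "(\<Sum>i<CARD('m). v $ e i *\<^sub>R b i) \<bullet> (\<Sum>j<CARD('m). w $ e j *\<^sub>R b j)
    = (\<Sum>i<CARD('m). \<Sum>j<CARD('m). v $ e i * (w $ e j * (if i = j then 1 else 0)))"
    using b by (auto simp: inner_sum_left inner_sum_right orthonormal_frame_def sum_distrib_left
      simp del: mult_delta_right intro!: sum.cong)
  also have "\<dots> = (\<Sum>i<CARD('m). v $ e i * w $ e i)"
    by (intro sum.cong) (auto simp: if_distrib cong: if_cong)
  also have "\<dots> = v \<bullet> w"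
    unfolding inner_vec_def by (simp add: sum.reindex_bij_betw[OF e, of "\<lambda>j. v $ j * w $ j"])
  finally show "(\<Sum>i<CARD('m). v $ e i *\<^sub>R b i) \<bullet> (\<Sum>j<CARD('m). w $ e j *\<^sub>R b j) = v \<bullet> w" .
qed

lemma distr_PiM_frame:
  fixes b :: "nat \<Rightarrow> real^'m"
  assumes b: "orthonormal_frame CARD('m) b"
  shows "distr (\<Pi>\<^sub>M i\<in>{..<CARD('m)}. lborel) borel (\<lambda>c. \<Sum>i<CARD('m). c i *\<^sub>R b i) = lborel"
proof -
  let ?M = "\<Pi>\<^sub>M i\<in>{..<CARD('m)}. lborel :: real measure"
  obtain e where e: "bij_betw e {..<CARD('m)} (UNIV :: 'm set)"
    using ex_bij_betw_nat_finite[of "UNIV :: 'm set"] by (auto simp: atLeast0LessThan)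
  define f :: "real^'m \<Rightarrow> real^'m" where "f x = (\<Sum>i<CARD('m). x $ e i *\<^sub>R b i)" for x
  have f: "orthogonal_transformation f"
    using frame_transformation[OF b e] by (simp add: f_def[abs_def])
  have [measurable]: "f \<in> borel_measurable borel"
    using f by (intro borel_measurable_continuous_onI linear_continuous_on)
      (auto simp: orthogonal_transformation_linear linear_linear)
  have "f (axis (e i) 1) = b i" if "i < CARD('m)" for i
  proof -
    have "f (axis (e i) 1) = (\<Sum>j<CARD('m). if j = i then b j else 0)"
      using e that unfolding f_def by (intro sum.cong) (auto simp: axis_def bij_betw_def inj_on_def)
    then show ?thesis using that by simp
  qed
  then have "f (\<Sum>i<CARD('m). c i *\<^sub>R axis (e i) 1) = (\<Sum>i<CARD('m). c i *\<^sub>R b i)" for c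
    using orthogonal_transformation_linear[OF f] by (simp add: linear_sum linear_cmul)
  then have "distr ?M borel (\<lambda>c. \<Sum>i<CARD('m). c i *\<^sub>R b i)
      = distr (distr ?M borel (\<lambda>c. \<Sum>i<CARD('m). c i *\<^sub>R axis (e i) 1)) borel f"
    by (subst distr_distr) (auto simp: comp_def)
  also have "\<dots> = lborel"
    by (simp add: distr_PiM_axis[OF _ e] distr_lborel_orthogonal[OF f])
  finally show ?thesis .
qed

text \<open>Surjectivity of the orthogonal map stands in for a spanning argument; inner products
  then read off the coefficients.\<close>

lemma frame_expand:
  fixes b :: "nat \<Rightarrow> real^'m"
  assumes b: "orthonormal_frame CARD('m) b"
  shows "x = (\<Sum>i<CARD('m). (x \<bullet> b i) *\<^sub>R b i)"
proof -
  obtain e where e: "bij_betw e {..<CARD('m)} (UNIV :: 'm set)"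
    using ex_bij_betw_nat_finite[of "UNIV :: 'm set"] by (auto simp: atLeast0LessThan)
  have "surj (\<lambda>x. \<Sum>i<CARD('m). x $ e i *\<^sub>R b i)"
    using frame_transformation[OF b e] by (rule orthogonal_transformation_surj)
  then obtain y where y: "x = (\<Sum>i<CARD('m). y $ e i *\<^sub>R b i)" by auto
  have "x \<bullet> b i = y $ e i" if "i < CARD('m)" for i
  proof -
    have "x \<bullet> b i = (\<Sum>j<CARD('m). if j = i then y $ e j else 0)"
      using b that unfolding y inner_sum_left
      by (intro sum.cong) (auto simp: orthonormal_frame_def)
    then show ?thesis using that by simp
  qed
  then show ?thesis using y by simp
qed

section \<open>Slices of the orthant\<close>

definition coord_sum :: "real^'m \<Rightarrow> real" where
  "coord_sum x = (\<Sum>j\<in>UNIV. x $ j)"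

lemma coord_sum_add[simp]: "coord_sum (x + y) = coord_sum x + coord_sum y"
  and coord_sum_diff[simp]: "coord_sum (x - y) = coord_sum x - coord_sum y"
  and coord_sum_scaleR[simp]: "coord_sum (c *\<^sub>R x) = c * coord_sum x"
  and coord_sum_sum[simp]: "coord_sum (\<Sum>i\<in>I. g i) = (\<Sum>i\<in>I. coord_sum (g i))"
  and coord_sum_axis[simp]: "coord_sum (axis j c) = c"
  and coord_sum_const[simp]: "coord_sum ((\<chi> j. c) :: real^'m) = real CARD('m) * c" for x y :: "real^'m"
  by (auto simp: coord_sum_def sum.distrib sum_subtractf sum_distrib_left axis_def intro: sum.swap)

lemma inner_const_eq_coord_sum: "x \<bullet> (\<chi> j. c) = c * coord_sum x" "(\<chi> j. c) \<bullet> x = c * coord_sum x"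
  by (simp_all add: inner_vec_def coord_sum_def sum_distrib_left mult.commute)

lemma borel_measurable_coord_sum[measurable]: "coord_sum \<in> borel_measurable borel"
  unfolding coord_sum_def[abs_def] by (intro borel_measurable_continuous_onI continuous_intros)

definition nonneg_orthant :: "(real^'m) set" where
  "nonneg_orthant = {x. \<forall>j. 0 \<le> x $ j}"

lemma nonneg_orthant_borel[measurable]: "nonneg_orthant \<in> sets borel"
  unfolding nonneg_orthant_def by (intro borel_closed closed_Collect_all closed_Collect_le continuous_intros)

lemma borel_measurable_frame_sum[measurable]:
  fixes b :: "nat \<Rightarrow> 'a::euclidean_space"
  shows "(\<lambda>c. \<Sum>i<k. c i *\<^sub>R b i) \<in> borel_measurable (\<Pi>\<^sub>M i\<in>{..<k}. lborel)"
  by (intro borel_measurable_sum borel_measurable_scaleR) auto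

text \<open>The dimension of the slice is \<open>k\<close>, that is \<open>n - 1\<close>, and
  \<open>b\<close> spans its directions; \<open>b\<close> is a parameter because
  \<open>flat_vol\<close> leaves the choice of frame open. \<open>D\<close> is the area of the
  parallelogram spanned by \<open>(1, ..., 1)\<close> and \<open>a\<close>, whose Gram determinant
  is \<open>k + 2 - \<kappa>\<^sup>2\<close>.\<close>

locale simplex_slice =
  fixes a :: "real^'m" and b :: "nat \<Rightarrow> real^'m" and \<kappa> D :: real and k :: nat
  assumes card: "CARD('m) = k + 2"
    and frame: "orthonormal_frame k b"
    and coord_sum_b: "\<And>i. i < k \<Longrightarrow> coord_sum (b i) = 0"
    and b_a: "\<And>i. i < k \<Longrightarrow> b i \<bullet> a = 0"
    and coord_sum_a: "coord_sum a = \<kappa>"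
    and norm_a: "a \<bullet> a = 1"
    and D_pos: "0 < D"
    and D_sq: "D\<^sup>2 = real k + 2 - \<kappa>\<^sup>2"
begin

definition N :: real where "N = real k + 2"

lemma N_pos: "0 < N" by (simp add: N_def)

definition u1 :: "real^'m" where "u1 = (\<chi> j. 1 / sqrt N)"

text \<open>Gram-Schmidt: the part of \<open>a\<close> orthogonal to \<open>(1, ..., 1)\<close> has
  norm \<open>D / sqrt N\<close> and is normalized here.\<close>

definition u2 :: "real^'m" where "u2 = (1 / D) *\<^sub>R (sqrt N *\<^sub>R a - (\<chi> j. \<kappa> / sqrt N))"

lemma u_props: "coord_sum u1 = sqrt N" "u1 \<bullet> a = \<kappa> / sqrt N" "u1 \<bullet> u1 = 1"
  "coord_sum u2 = 0" "u2 \<bullet> a = D / sqrt N" "u1 \<bullet> u2 = 0" "u2 \<bullet> u2 = 1"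
proof -
  have c: "real CARD('m) = N" by (simp add: card N_def)
  have s: "sqrt N * sqrt N = N" "sqrt N \<noteq> 0" using N_pos by auto
  have s': "N / sqrt N = sqrt N" using N_pos by (simp add: real_div_sqrt)
  have D': "D * D = N - \<kappa> * \<kappa>" using D_sq by (simp add: power2_eq_square N_def)
  show u1: "coord_sum u1 = sqrt N" using s' by (simp add: u1_def c)
  show u1a: "u1 \<bullet> a = \<kappa> / sqrt N" by (simp add: u1_def inner_const_eq_coord_sum coord_sum_a)
  show "u1 \<bullet> u1 = 1" using u1 s unfolding u1_def by (simp add: inner_const_eq_coord_sum)
  show u2: "coord_sum u2 = 0" using s' by (simp add: u2_def c coord_sum_a)
      (metis mult.commute times_divide_eq_right)
  show u2a: "u2 \<bullet> a = D / sqrt N"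
  proof -
    have "sqrt N - \<kappa> / sqrt N * \<kappa> = D * D / sqrt N"
      unfolding D' by (simp add: diff_divide_distrib s')
    then show ?thesis using D_pos by (simp add: u2_def inner_diff_left inner_const_eq_coord_sum coord_sum_a norm_a)
  qed
  show "u1 \<bullet> u2 = 0" using u2 by (simp add: u1_def inner_const_eq_coord_sum)
  have "u2 \<bullet> u2 = (1 / D) * (sqrt N * (u2 \<bullet> a) - u2 \<bullet> (\<chi> j. \<kappa> / sqrt N))"
    by (subst (2) u2_def) (simp add: inner_diff_right)
  also have "\<dots> = 1" using u2 u2a s D_pos by (simp add: inner_const_eq_coord_sum)
  finally show "u2 \<bullet> u2 = 1" .
qed

lemma b_u: "i < k \<Longrightarrow> b i \<bullet> u1 = 0" "i < k \<Longrightarrow> b i \<bullet> u2 = 0"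
  by (simp_all add: u1_def u2_def inner_diff_right inner_const_eq_coord_sum coord_sum_b b_a)

definition full_frame :: "nat \<Rightarrow> real^'m" where
  "full_frame i = (if i < k then b i else if i = k then u1 else u2)"

lemma orthonormal_full_frame: "orthonormal_frame CARD('m) full_frame"
  unfolding orthonormal_frame_def
proof (intro allI impI)
  fix i j assume "i < CARD('m)" "j < CARD('m)"
  then have ij: "i < k \<or> i = k \<or> i = Suc k" "j < k \<or> j = k \<or> j = Suc k" by (auto simp: card)
  have comm: "u2 \<bullet> u1 = 0" "\<And>i. i < k \<Longrightarrow> u1 \<bullet> b i = 0" "\<And>i. i < k \<Longrightarrow> u2 \<bullet> b i = 0"
    using u_props(6) b_u by (simp_all add: inner_commute)
  have "b i \<bullet> b j = (if i = j then 1 else 0)" if "i < k" "j < k" for i j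
    using frame that by (simp add: orthonormal_frame_def)
  with ij comm show "full_frame i \<bullet> full_frame j = (if i = j then 1 else 0)"
    by (elim disjE) (simp_all add: full_frame_def u_props b_u)
qed

definition section_vol :: "real^'m \<Rightarrow> ennreal" where
  "section_vol z = (\<integral>\<^sup>+c. indicator nonneg_orthant (z + (\<Sum>i<k. c i *\<^sub>R b i)) \<partial>(\<Pi>\<^sub>M i\<in>{..<k}. lborel))"

lemma borel_measurable_section_vol[measurable]: "section_vol \<in> borel_measurable borel"
proof -
  interpret finite_product_sigma_finite "\<lambda>_. lborel :: real measure" "{..<k}" by standard simp
  show ?thesis unfolding section_vol_def[abs_def] by measurable
qed

text \<open>The orthant is a cone, so dilation by \<open>l\<close> scales slices by
  \<open>l ^ k\<close>; the shift \<open>d\<close> along the frame is undone by the substitution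
  \<open>- d i + l * c i\<close>.\<close>

lemma section_vol_affine:
  assumes l: "0 < l"
  shows "section_vol (l *\<^sub>R z + (\<Sum>i<k. d i *\<^sub>R b i)) = ennreal (l ^ k) * section_vol z"
proof -
  have "section_vol (l *\<^sub>R z + (\<Sum>i<k. d i *\<^sub>R b i)) = ennreal (l ^ card {..<k}) *
    (\<integral>\<^sup>+c. indicator nonneg_orthant (l *\<^sub>R z + (\<Sum>i<k. d i *\<^sub>R b i)
       + (\<Sum>i<k. (\<lambda>i\<in>{..<k}. - d i + l * c i) i *\<^sub>R b i)) \<partial>(\<Pi>\<^sub>M i\<in>{..<k}. lborel))"
    unfolding section_vol_def using l by (intro nn_integral_PiM_affine) auto
  also have "(\<integral>\<^sup>+c. indicator nonneg_orthant (l *\<^sub>R z + (\<Sum>i<k. d i *\<^sub>R b i)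
       + (\<Sum>i<k. (\<lambda>i\<in>{..<k}. - d i + l * c i) i *\<^sub>R b i)) \<partial>(\<Pi>\<^sub>M i\<in>{..<k}. lborel)) = section_vol z"
    unfolding section_vol_def
  proof (rule nn_integral_cong)
    fix c :: "nat \<Rightarrow> real"
    have "l *\<^sub>R z + (\<Sum>i<k. d i *\<^sub>R b i) + (\<Sum>i<k. (\<lambda>i\<in>{..<k}. - d i + l * c i) i *\<^sub>R b i)
      = l *\<^sub>R (z + (\<Sum>i<k. c i *\<^sub>R b i))"
      by (simp add: scaleR_right_distrib scaleR_sum_right scaleR_left_distrib sum.distrib sum_negf
          scaleR_left_diff_distrib sum_subtractf)
    moreover have "l *\<^sub>R y \<in> nonneg_orthant \<longleftrightarrow> y \<in> nonneg_orthant" for y :: "real^'m"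
      using l by (simp add: nonneg_orthant_def zero_le_mult_iff)
    ultimately show "indicator nonneg_orthant (l *\<^sub>R z + (\<Sum>i<k. d i *\<^sub>R b i)
         + (\<Sum>i<k. (\<lambda>i\<in>{..<k}. - d i + l * c i) i *\<^sub>R b i))
      = (indicator nonneg_orthant (z + (\<Sum>i<k. c i *\<^sub>R b i)) :: ennreal)"
      by (simp only: indicator_def)
  qed
  finally show ?thesis by simp
qed

text \<open>The difference of the points is orthogonal to \<open>u1\<close> and \<open>u2\<close>,
  hence a combination of the \<open>b i\<close>.\<close>

lemma section_vol_cong:
  assumes "coord_sum z = coord_sum z'" "z \<bullet> a = z' \<bullet> a"
  shows "section_vol z = section_vol z'"
proof -
  have "(z - z') \<bullet> u1 = 0" "(z - z') \<bullet> u2 = 0"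
    using assms by (simp_all add: u1_def u2_def inner_diff_right inner_diff_left inner_const_eq_coord_sum)
  then have "z - z' = (\<Sum>i<k. ((z - z') \<bullet> b i) *\<^sub>R b i)"
    using frame_expand[OF orthonormal_full_frame, of "z - z'"] by (simp add: card full_frame_def)
  then have "z = 1 *\<^sub>R z' + (\<Sum>i<k. ((z - z') \<bullet> b i) *\<^sub>R b i)"
    by (subst (asm) diff_eq_eq) (simp add: add.commute)
  then have "section_vol z = section_vol (1 *\<^sub>R z' + (\<Sum>i<k. ((z - z') \<bullet> b i) *\<^sub>R b i))"
    by (rule arg_cong)
  also have "\<dots> = section_vol z'" by (subst section_vol_affine) auto
  finally show ?thesis .
qed

text \<open>Adding \<open>w\<close> keeps the orthant inside itself, with the same coordinates
  \<open>c\<close>. All control of \<open>slice_density\<close> near 0 rests on this.\<close>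

lemma section_vol_mono:
  assumes "w \<in> nonneg_orthant"
  shows "section_vol z \<le> section_vol (z + w)"
  unfolding section_vol_def using assms
  by (intro nn_integral_mono) (auto simp: nonneg_orthant_def indicator_def add.assoc add.left_commute add.commute[of _ w])

lemma section_vol_eq_0:
  assumes "coord_sum z < 0"
  shows "section_vol z = 0"
proof -
  have "z + (\<Sum>i<k. c i *\<^sub>R b i) \<notin> nonneg_orthant" for c
  proof
    assume "z + (\<Sum>i<k. c i *\<^sub>R b i) \<in> nonneg_orthant"
    then have "0 \<le> coord_sum (z + (\<Sum>i<k. c i *\<^sub>R b i))"
      unfolding coord_sum_def nonneg_orthant_def by (intro sum_nonneg) auto
    then show False using assms by (simp add: coord_sum_b)
  qed
  then show ?thesis by (simp add: section_vol_def)
qed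

definition plane_point :: "real \<Rightarrow> real \<Rightarrow> real^'m" where
  "plane_point S Y = (S / sqrt N) *\<^sub>R u1 + ((sqrt N * Y - \<kappa> * S / sqrt N) / D) *\<^sub>R u2"

lemma plane_point_props: "coord_sum (plane_point S Y) = S" "plane_point S Y \<bullet> a = Y"
  using N_pos D_pos by (auto simp: plane_point_def u_props inner_add_left field_simps)

lemma plane_point_measurable[measurable]: "(\<lambda>(S, Y). plane_point S Y) \<in> borel_measurable (borel \<Otimes>\<^sub>M borel)"
  unfolding plane_point_def by measurable

text \<open>
  The plane spanned by \<open>a\<close> and \<open>(1, \<dots>, 1)\<close> is parametrized by the values \<open>S\<close> and \<open>Y\<close> of \<open>coord_sum\<close> and
  of the inner product with \<open>a\<close>; the factor \<open>1 / D\<close> is the Jacobian of this parametrization.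
\<close>

definition slice_density :: "real \<Rightarrow> ennreal" where
  "slice_density Y = ennreal (1 / D) * (\<integral>\<^sup>+S. ennreal (exp (- S)) * section_vol (plane_point S Y) \<partial>lborel)"

lemma borel_measurable_slice_density[measurable]: "slice_density \<in> borel_measurable borel"
  unfolding slice_density_def[abs_def] by measurable

text \<open>The slices at level \<open>Y = 0\<close> are dilates of one another, so the integral
  over \<open>S\<close> is the Gamma integral of \<open>S ^ k * exp (- S)\<close>.\<close>

lemma slice_density_0: "slice_density 0 = ennreal (fact k / D) * section_vol (plane_point 1 0)"
proof -
  have "(\<integral>\<^sup>+S. ennreal (exp (- S)) * section_vol (plane_point S 0) \<partial>lborel)
    = (\<integral>\<^sup>+S. ennreal (S ^ k * exp (- S)) * indicator {0..} S * section_vol (plane_point 1 0) \<partial>lborel)"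
  proof (rule nn_integral_cong_AE)
    show "AE S in lborel. ennreal (exp (- S)) * section_vol (plane_point S 0) = ennreal (S ^ k * exp (- S)) * indicator {0..} S * section_vol (plane_point 1 0)"
      using AE_lborel_singleton[of 0]
    proof eventually_elim
      case (elim S)
      show ?case
      proof (cases "0 < S")
        case True
        have "section_vol (plane_point S 0) = section_vol (S *\<^sub>R plane_point 1 0)" by (rule section_vol_cong) (simp_all add: plane_point_props)
        also have "\<dots> = ennreal (S ^ k) * section_vol (plane_point 1 0)"
          using section_vol_affine[OF True, of "plane_point 1 0" "\<lambda>_. 0"] by simp
        finally show ?thesis using True by (simp add: ennreal_mult ac_simps)
      next
        case False
        then show ?thesis using elim by (simp add: section_vol_eq_0 plane_point_props)
      qed
    qed
  qed
  also have "\<dots> = ennreal (fact k) * section_vol (plane_point 1 0)"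
    by (simp add: nn_integral_multc nn_intergal_power_times_exp_Ici)
  finally show ?thesis
    using D_pos by (simp add: slice_density_def mult.assoc[symmetric] ennreal_mult[symmetric])
qed

text \<open>
  Adding \<open>e\<close> times the \<open>j\<close>-th unit vector moves a slice of the orthant into another slice. Together with
  a positive and a negative coordinate of \<open>a\<close>, this controls \<open>slice_density\<close> at 0, where the
  almost everywhere defined density says nothing.
\<close>

lemma slice_density_shift:
  assumes "0 \<le> e"
  shows "slice_density y \<le> ennreal (exp e) * slice_density (y + e * a $ j)"
proof -
  have "(\<integral>\<^sup>+S. ennreal (exp (- S)) * section_vol (plane_point S y) \<partial>lborel)
    \<le> (\<integral>\<^sup>+S. ennreal (exp e) * (ennreal (exp (- (e + S))) * section_vol (plane_point (e + S) (y + e * a $ j))) \<partial>lborel)"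
  proof (intro nn_integral_mono)
    fix S
    have "section_vol (plane_point S y) \<le> section_vol (plane_point S y + e *\<^sub>R axis j 1)"
      using assms by (intro section_vol_mono) (auto simp: nonneg_orthant_def axis_def)
    also have "\<dots> = section_vol (plane_point (e + S) (y + e * a $ j))"
      by (rule section_vol_cong) (simp_all add: plane_point_props inner_add_left inner_axis' )
    finally show "ennreal (exp (- S)) * section_vol (plane_point S y)
      \<le> ennreal (exp e) * (ennreal (exp (- (e + S))) * section_vol (plane_point (e + S) (y + e * a $ j)))"
      by (simp add: mult.assoc[symmetric] ennreal_mult[symmetric] exp_add[symmetric] mult_left_mono)
  qed
  also have "\<dots> = ennreal (exp e) * (\<integral>\<^sup>+S. ennreal (exp (- S)) * section_vol (plane_point S (y + e * a $ j)) \<partial>lborel)"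
    using nn_integral_shift[of "\<lambda>S. ennreal (exp (- S)) * section_vol (plane_point S (y + e * a $ j))" e]
    by (simp add: nn_integral_cmult)
  finally show ?thesis
    unfolding slice_density_def by (subst mult.left_commute) (rule mult_left_mono, auto)
qed

text \<open>In the coordinates of \<open>full_frame\<close> the first \<open>k\<close> variables
  affect only the indicator and integrate to \<open>section_vol\<close>; the other two are then
  replaced by \<open>S\<close> and \<open>Y\<close>.\<close>

lemma nn_integral_slices:
  assumes [measurable]: "h \<in> borel_measurable borel"
  shows "(\<integral>\<^sup>+x. indicator nonneg_orthant x * ennreal (exp (- coord_sum x)) * h (x \<bullet> a) \<partial>lborel)
    = (\<integral>\<^sup>+Y. h Y * slice_density Y \<partial>lborel)"
proof -
  define H where "H x = indicator nonneg_orthant x * ennreal (exp (- coord_sum x)) * h (x \<bullet> a)" for x :: "real^'m"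
  have [measurable]: "H \<in> borel_measurable borel" unfolding H_def[abs_def] by measurable
  define G where "G \<alpha> \<beta> = ennreal (exp (- (sqrt N * \<alpha>))) * h (\<alpha> * \<kappa> / sqrt N + \<beta> * D / sqrt N) * section_vol (\<alpha> *\<^sub>R u1 + \<beta> *\<^sub>R u2)" for \<alpha> \<beta>
  have [measurable]: "(\<lambda>(\<alpha>, \<beta>). G \<alpha> \<beta>) \<in> borel_measurable (borel \<Otimes>\<^sub>M borel)"
    unfolding G_def by measurable
  have card': "CARD('m) = Suc (Suc k)" by (simp add: card)
  have "(\<integral>\<^sup>+x. H x \<partial>lborel)
      = (\<integral>\<^sup>+x. H x \<partial>distr (\<Pi>\<^sub>M i\<in>{..<CARD('m)}. lborel) borel (\<lambda>c. \<Sum>i<CARD('m). c i *\<^sub>R full_frame i))"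
    by (simp only: distr_PiM_frame[OF orthonormal_full_frame])
  also have "\<dots> = (\<integral>\<^sup>+c. H (\<Sum>i<CARD('m). c i *\<^sub>R full_frame i) \<partial>(\<Pi>\<^sub>M i\<in>{..<CARD('m)}. lborel))"
    by (rule nn_integral_distr) measurable
  also have "\<dots> = (\<integral>\<^sup>+c. H (\<Sum>i<Suc (Suc k). c i *\<^sub>R full_frame i) \<partial>(\<Pi>\<^sub>M i\<in>insert (Suc k) {..<Suc k}. lborel))"
    unfolding card' by (simp only: lessThan_Suc)
  also have "\<dots> = (\<integral>\<^sup>+\<beta>. \<integral>\<^sup>+c. H (\<Sum>i<Suc (Suc k). (c(Suc k := \<beta>)) i *\<^sub>R full_frame i) \<partial>(\<Pi>\<^sub>M i\<in>{..<Suc k}. lborel) \<partial>lborel)"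
    by (rule lborel_PiM.product_nn_integral_insert_rev) (auto simp flip: lessThan_Suc)
  also have "\<dots> = (\<integral>\<^sup>+\<beta>. \<integral>\<^sup>+\<alpha>. \<integral>\<^sup>+c. H (\<Sum>i<Suc (Suc k). (c(k := \<alpha>, Suc k := \<beta>)) i *\<^sub>R full_frame i)
      \<partial>(\<Pi>\<^sub>M i\<in>{..<k}. lborel) \<partial>lborel \<partial>lborel)"
  proof (rule nn_integral_cong)
    fix \<beta> :: real
    have [measurable]: "(\<lambda>c. c(Suc k := \<beta>)) \<in> measurable (\<Pi>\<^sub>M i\<in>{..<Suc k}. lborel) (\<Pi>\<^sub>M i\<in>{..<Suc (Suc k)}. lborel :: real measure)"
      by (rule measurable_fun_upd[where J = "{..<Suc k}"]) auto
    have "(\<lambda>c. H (\<Sum>i<Suc (Suc k). (c(Suc k := \<beta>)) i *\<^sub>R full_frame i)) \<in> borel_measurable (\<Pi>\<^sub>M i\<in>{..<Suc k}. lborel)"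
      by measurable
    then show "(\<integral>\<^sup>+c. H (\<Sum>i<Suc (Suc k). (c(Suc k := \<beta>)) i *\<^sub>R full_frame i) \<partial>(\<Pi>\<^sub>M i\<in>{..<Suc k}. lborel))
      = (\<integral>\<^sup>+\<alpha>. \<integral>\<^sup>+c. H (\<Sum>i<Suc (Suc k). (c(k := \<alpha>, Suc k := \<beta>)) i *\<^sub>R full_frame i) \<partial>(\<Pi>\<^sub>M i\<in>{..<k}. lborel) \<partial>lborel)"
      unfolding lessThan_Suc[of k]
      by (intro lborel_PiM.product_nn_integral_insert_rev) auto
  qed
  also have "\<dots> = (\<integral>\<^sup>+\<beta>. \<integral>\<^sup>+\<alpha>. \<integral>\<^sup>+c. H ((\<Sum>i<k. c i *\<^sub>R b i) + \<alpha> *\<^sub>R u1 + \<beta> *\<^sub>R u2) \<partial>(\<Pi>\<^sub>M i\<in>{..<k}. lborel) \<partial>lborel \<partial>lborel)"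
    by (simp add: full_frame_def)
  also have "\<dots> = (\<integral>\<^sup>+\<beta>. \<integral>\<^sup>+\<alpha>. G \<alpha> \<beta> \<partial>lborel \<partial>lborel)"
  proof (rule nn_integral_cong, rule nn_integral_cong)
    fix \<alpha> \<beta> :: real
    have "H ((\<Sum>i<k. c i *\<^sub>R b i) + \<alpha> *\<^sub>R u1 + \<beta> *\<^sub>R u2)
      = (ennreal (exp (- (sqrt N * \<alpha>))) * h (\<alpha> * \<kappa> / sqrt N + \<beta> * D / sqrt N)) *
        indicator nonneg_orthant ((\<alpha> *\<^sub>R u1 + \<beta> *\<^sub>R u2) + (\<Sum>i<k. c i *\<^sub>R b i))" for c
      by (simp add: H_def u_props coord_sum_b b_a inner_add_left inner_sum_left ac_simps)
    then show "(\<integral>\<^sup>+c. H ((\<Sum>i<k. c i *\<^sub>R b i) + \<alpha> *\<^sub>R u1 + \<beta> *\<^sub>R u2) \<partial>(\<Pi>\<^sub>M i\<in>{..<k}. lborel)) = G \<alpha> \<beta>"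
      by (simp add: G_def section_vol_def nn_integral_cmult)
  qed
  also have "\<dots> = (\<integral>\<^sup>+\<alpha>. \<integral>\<^sup>+\<beta>. G \<alpha> \<beta> \<partial>lborel \<partial>lborel)"
    by (rule lborel_pair.Fubini') measurable
  \<comment> \<open>For fixed \<open>\<alpha>\<close> the new \<open>\<beta>\<close> solves
    \<open>x \<bullet> a = Y\<close>. Together with \<open>\<alpha> = S / sqrt N\<close> in the next
    step, the factors multiply to \<open>1 / D\<close>.\<close>
  also have "\<dots> = (\<integral>\<^sup>+\<alpha>. ennreal (sqrt N / D) * (\<integral>\<^sup>+Y. G \<alpha> (- (\<kappa> * \<alpha> / D) + sqrt N / D * Y) \<partial>lborel) \<partial>lborel)"
  proof (rule nn_integral_cong)
    fix \<alpha> :: real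
    show "(\<integral>\<^sup>+\<beta>. G \<alpha> \<beta> \<partial>lborel)
      = ennreal (sqrt N / D) * (\<integral>\<^sup>+Y. G \<alpha> (- (\<kappa> * \<alpha> / D) + sqrt N / D * Y) \<partial>lborel)"
      using N_pos D_pos
      by (subst nn_integral_real_affine[where c = "sqrt N / D" and t = "- (\<kappa> * \<alpha> / D)"]) auto
  qed
  also have "\<dots> = ennreal (1 / sqrt N) * (\<integral>\<^sup>+S. ennreal (sqrt N / D) *
      (\<integral>\<^sup>+Y. G (S / sqrt N) (- (\<kappa> * (S / sqrt N) / D) + sqrt N / D * Y) \<partial>lborel) \<partial>lborel)"
    using N_pos D_pos
    by (subst nn_integral_real_affine[where c = "1 / sqrt N" and t = 0]) auto
  also have "\<dots> = ennreal (1 / D) * (\<integral>\<^sup>+S. \<integral>\<^sup>+Y. ennreal (exp (- S)) * h Y * section_vol (plane_point S Y) \<partial>lborel \<partial>lborel)"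
  proof -
    have eq: "G (S / sqrt N) (- (\<kappa> * (S / sqrt N) / D) + sqrt N / D * Y) = ennreal (exp (- S)) * h Y * section_vol (plane_point S Y)" for S Y
    proof -
      have "S / sqrt N * \<kappa> / sqrt N + (- (\<kappa> * (S / sqrt N) / D) + sqrt N / D * Y) * D / sqrt N = Y"
        using N_pos D_pos by (simp add: field_simps)
      moreover have "- (\<kappa> * (S / sqrt N) / D) + sqrt N / D * Y = (sqrt N * Y - \<kappa> * S / sqrt N) / D"
        by (simp add: diff_divide_distrib)
      ultimately show ?thesis
        using N_pos by (simp add: G_def plane_point_def)
    qed
    show ?thesis
      unfolding eq using N_pos D_pos
      by (subst nn_integral_cmult) (auto simp: mult.assoc[symmetric] ennreal_mult[symmetric])
  qed
  also have "(\<integral>\<^sup>+S. \<integral>\<^sup>+Y. ennreal (exp (- S)) * h Y * section_vol (plane_point S Y) \<partial>lborel \<partial>lborel)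
    = (\<integral>\<^sup>+Y. \<integral>\<^sup>+S. ennreal (exp (- S)) * h Y * section_vol (plane_point S Y) \<partial>lborel \<partial>lborel)"
    by (rule lborel_pair.Fubini') measurable
  also have "ennreal (1 / D) * \<dots> = (\<integral>\<^sup>+Y. h Y * slice_density Y \<partial>lborel)"
    unfolding slice_density_def
    by (subst nn_integral_cmult[symmetric], measurable, intro nn_integral_cong)
       (simp add: nn_integral_cmult[symmetric] ac_simps)
  finally show ?thesis by (simp add: H_def)
qed

end

section \<open>From almost every point to the point 0\<close>

lemma AE_lborel_interval:
  fixes d :: real
  assumes "AE y in lborel. P y" "0 < d"
  shows "\<exists>y. 0 < y \<and> y < d \<and> P y"
proof (rule ccontr)
  assume "\<not> ?thesis"
  then have "AE y in lborel. y \<notin> {0<..<d}"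
    using assms(1) by (auto elim!: eventually_mono)
  then have "emeasure lborel {0<..<d} = 0"
    by (subst (asm) AE_iff_measurable[where N = "{0<..<d}"]) auto
  then show False using assms(2) by simp
qed

text \<open>Points satisfying \<open>P\<close> lie arbitrarily close to 0 on the right, so the bound
  survives in the limit. Continuity is asked of the comparison function \<open>\<phi>\<close> only,
  not of the densities that enter \<open>P\<close>.\<close>

lemma AE_right_limit:
  fixes \<phi> :: "real \<Rightarrow> real"
  assumes AE: "AE y in lborel. P y" and cont: "isCont \<phi> 0" and le: "\<And>y. 0 < y \<Longrightarrow> P y \<Longrightarrow> c \<le> \<phi> y"
  shows "c \<le> \<phi> 0"
proof (rule ccontr)
  assume "\<not> c \<le> \<phi> 0"
  then have "\<forall>\<^sub>F y in at 0. \<phi> y < c"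
    using cont by (intro order_tendstoD(2)[of \<phi> "\<phi> 0"]) (auto simp: isCont_def)
  then obtain d where d: "0 < d" "\<And>y. y \<noteq> 0 \<Longrightarrow> \<bar>y\<bar> < d \<Longrightarrow> \<phi> y < c"
    unfolding eventually_at by (auto simp: dist_real_def)
  obtain y where "0 < y" "y < d" "P y" using AE_lborel_interval[OF AE d(1)] by blast
  with le[of y] d(2)[of y] show False by simp
qed

lemma sum_density_AE_unique:
  assumes "sum_density J a f" "sum_density J a g"
  shows "AE y in lborel. f y = g y"
proof (rule sigma_finite_measure.density_unique[OF sigma_finite_lborel])
  note [measurable] = sum_density_measurable[OF assms(1)] sum_density_measurable[OF assms(2)]
  show "f \<in> borel_measurable lborel" "g \<in> borel_measurable lborel" by simp_all
  show "density lborel f = density lborel g"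
  proof (rule measure_eqI)
    fix A :: "real set" assume "A \<in> sets (density lborel f)"
    then have [measurable]: "A \<in> sets borel" by simp
    have "(\<integral>\<^sup>+y. indicator A y * f y \<partial>lborel) = (\<integral>\<^sup>+y. indicator A y * g y \<partial>lborel)"
      by (simp flip: sum_densityD[OF assms(1)] sum_densityD[OF assms(2)])
    then show "emeasure (density lborel f) A = emeasure (density lborel g) A"
      by (simp add: emeasure_density mult.commute)
  qed simp
qed

text \<open>From \<open>max 0 w <= max 0 (w - y) + y\<close> and total mass 1. It bounds the error
  made by estimating at a nearby \<open>y\<close> instead of 0.\<close>

lemma tail_tail_Lipschitz:
  assumes [measurable]: "f \<in> borel_measurable borel" and "(\<integral>\<^sup>+y. f y \<partial>lborel) = 1" "0 \<le> y"
  shows "tail (tail f) 0 \<le> tail (tail f) y + ennreal y"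
proof -
  have "tail (tail f) 0 \<le> (\<integral>\<^sup>+w. f w * ennreal (max 0 (w - y)) + f w * ennreal y \<partial>lborel)"
    unfolding tail_tail_eq[OF assms(1)] using assms(3)
    by (intro nn_integral_mono) (auto simp: distrib_left[symmetric] ennreal_plus[symmetric]
        simp del: ennreal_plus intro!: mult_left_mono ennreal_leI)
  also have "\<dots> = tail (tail f) y + ennreal y"
    using assms(2) by (simp add: nn_integral_add nn_integral_multc tail_tail_eq)
  finally show ?thesis .
qed

context simplex_slice
begin

text \<open>One integral over the orthant in two coordinate systems: along the axes the weight is a
  product of exponential densities, in the adapted frame it is sliced.\<close>

lemma sum_density_slice_density: "sum_density UNIV (($) a) slice_density"
  unfolding sum_density_def
proof (intro conjI ballI)
  fix h :: "real \<Rightarrow> ennreal" assume [measurable]: "h \<in> borel_measurable borel"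
  define H where "H x = indicator nonneg_orthant x * ennreal (exp (- coord_sum x)) * h (x \<bullet> a)" for x :: "real^'m"
  have [measurable]: "H \<in> borel_measurable borel" unfolding H_def[abs_def] by measurable
  let ?M = "\<Pi>\<^sub>M j\<in>(UNIV :: 'm set). lborel :: real measure"
  let ?g = "\<lambda>c. \<Sum>j\<in>(UNIV :: 'm set). c j *\<^sub>R axis j (1::real)"
  have g: "?g c $ j = c j" for c j
    by (simp add: sum_component axis_def if_distrib cong: if_cong)
  have [measurable]: "?g \<in> borel_measurable ?M"
    by (intro borel_measurable_sum borel_measurable_scaleR) auto
  have "(\<integral>\<^sup>+Y. h Y * slice_density Y \<partial>lborel) = (\<integral>\<^sup>+x. H x \<partial>lborel)"
    using nn_integral_slices[of h] by (simp add: H_def)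
  also have "\<dots> = (\<integral>\<^sup>+x. H x \<partial>distr ?M borel ?g)"
    using distr_PiM_axis[of UNIV "id :: 'm \<Rightarrow> 'm"] by simp
  also have "\<dots> = (\<integral>\<^sup>+c. H (?g c) \<partial>?M)"
    by (rule nn_integral_distr) measurable
  also have "\<dots> = (\<integral>\<^sup>+c. h (\<Sum>j\<in>UNIV. a $ j * c j) * (\<Prod>j\<in>UNIV. expd (c j)) \<partial>?M)"
  proof (rule nn_integral_cong)
    fix c :: "'m \<Rightarrow> real"
    have tot: "coord_sum (?g c) = (\<Sum>j\<in>UNIV. c j)" by simp
    have orth: "?g c \<in> nonneg_orthant \<longleftrightarrow> (\<forall>j. 0 \<le> c j)"
      unfolding nonneg_orthant_def mem_Collect_eq g ..
    have "(\<Prod>j\<in>UNIV. expd (c j)) = indicator nonneg_orthant (?g c) * ennreal (exp (- coord_sum (?g c)))"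
    proof (cases "\<forall>j. 0 \<le> c j")
      case True
      then show ?thesis
        unfolding tot indicator_def[of nonneg_orthant] orth
        by (simp add: expd_def prod_ennreal sum_negf[symmetric] exp_sum)
    next
      case False
      then obtain j where "\<not> 0 \<le> c j" by blast
      then have "expd (c j) = 0" by (simp add: expd_def)
      then have "(\<Prod>j\<in>UNIV. expd (c j)) = 0" by (intro prod_zero) auto
      moreover have "indicator nonneg_orthant (?g c) = (0 :: ennreal)"
        using False by (simp only: indicator_eq_0_iff orth not_False_eq_True)
      ultimately show ?thesis by (simp only: mult_zero_left)
    qed
    moreover have "?g c \<bullet> a = (\<Sum>j\<in>UNIV. a $ j * c j)"
      unfolding inner_vec_def g by (simp add: mult.commute)
    ultimately show "H (?g c) = h (\<Sum>j\<in>UNIV. a $ j * c j) * (\<Prod>j\<in>UNIV. expd (c j))"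
      by (simp add: H_def mult.commute)
  qed
  finally show "(\<integral>\<^sup>+c. h (\<Sum>j\<in>UNIV. a $ j * c j) * (\<Prod>j\<in>UNIV. expd (c j)) \<partial>?M) = (\<integral>\<^sup>+Y. h Y * slice_density Y \<partial>lborel)" ..
qed simp

text \<open>The shift by \<open>y / a $ j\<close> along axis \<open>j\<close> carries level 0 to
  level \<open>y\<close>. A negative coordinate serves for the way back in the next lemma.\<close>

lemma slice_density_0_le:
  assumes "0 < a $ j" "0 \<le> y"
  shows "slice_density 0 \<le> ennreal (exp (y / a $ j)) * slice_density y"
  using slice_density_shift[of "y / a $ j" 0 j] assms by simp

lemma slice_density_le_0:
  assumes "a $ j < 0" "0 \<le> y"
  shows "slice_density y \<le> ennreal (exp (- y / a $ j)) * slice_density 0"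
  using slice_density_shift[of "- y / a $ j" y j] assms by (simp add: divide_nonneg_neg)

text \<open>An integrable density is finite at some \<open>y\<close> in \<open>(0, 1)\<close>, and
  its value there dominates the value at 0 up to a finite factor.\<close>

lemma slice_density_0_finite:
  assumes j: "0 < a $ j"
  shows "slice_density 0 \<noteq> \<infinity>"
proof -
  have "(\<integral>\<^sup>+y. slice_density y \<partial>lborel) = 1"
    by (rule sum_density_total[OF _ sum_density_slice_density]) simp
  then have "AE y in lborel. slice_density y \<noteq> \<infinity>"
    by (intro nn_integral_PInf_AE) auto
  from AE_lborel_interval[OF this zero_less_one] obtain y where "0 < y" "slice_density y \<noteq> \<infinity>" by blast
  then show ?thesis
    using slice_density_0_le[OF j, of y] by (auto simp: ennreal_mult_eq_top_iff top_unique)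
qed

text \<open>At points \<open>y > 0\<close> where both densities agree, \<open>t\<close> is at most
  \<open>exp (y / a $ j) * f y\<close>, and \<open>logconc_tail_tail_le\<close> applies to
  \<open>f\<close> at \<open>y\<close>. The errors vanish as \<open>y\<close> decreases to
  0.\<close>

lemma slice_density_0_moment_bound:
  assumes j: "0 < a $ j" and f: "sum_density UNIV (($) a) f" and lc: "logconc f"
    and t: "slice_density 0 = ennreal t" "0 \<le> t" and p: "tail f 0 = ennreal p" "0 \<le> p"
    and m: "tail (tail f) 0 = ennreal m" "0 \<le> m"
  shows "t * m \<le> p\<^sup>2"
proof -
  note [measurable] = sum_density_measurable[OF f]
  have tot: "(\<integral>\<^sup>+y. f y \<partial>lborel) = 1" by (rule sum_density_total[OF _ f]) simp
  have "t * m \<le> exp (0 / a $ j) * p\<^sup>2 + t * 0"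
  proof (rule AE_right_limit[OF sum_density_AE_unique[OF f sum_density_slice_density]])
    show "isCont (\<lambda>y. exp (y / a $ j) * p\<^sup>2 + t * y) 0"
      using j by (intro continuous_intros) auto
    fix y :: real assume y: "0 < y" and eq: "f y = slice_density y"
    have "ennreal t * tail (tail f) y \<le> ennreal (exp (y / a $ j)) * (f y * tail (tail f) y)"
      using mult_right_mono[OF slice_density_0_le[OF j, of y], of "tail (tail f) y"] y
      by (simp add: t eq mult.assoc)
    also have "\<dots> \<le> ennreal (exp (y / a $ j)) * (tail f 0)\<^sup>2"
      using y tail_antimono[of 0 y f]
      by (intro mult_left_mono order.trans[OF logconc_tail_tail_le[OF _ lc]] power_mono) auto
    finally have 1: "ennreal t * tail (tail f) y \<le> ennreal (exp (y / a $ j) * p\<^sup>2)"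
      using p by (simp add: ennreal_mult ennreal_power)
    have "ennreal (t * m) \<le> ennreal t * (tail (tail f) y + ennreal y)"
      using mult_left_mono[OF tail_tail_Lipschitz[OF _ tot, of y], of "ennreal t"] y
      by (simp add: t m ennreal_mult)
    also have "\<dots> \<le> ennreal (exp (y / a $ j) * p\<^sup>2) + ennreal (t * y)"
      using 1 t y by (simp add: distrib_left ennreal_mult add_right_mono)
    finally show "t * m \<le> exp (y / a $ j) * p\<^sup>2 + t * y"
      using t y p by (simp add: ennreal_plus[symmetric] del: ennreal_plus)
  qed
  then show ?thesis by simp
qed

lemma slice_density_0_upper:
  assumes i: "0 < a $ i" and j: "a $ j < 0"
    and t: "slice_density 0 = ennreal t" "0 \<le> t"
  shows "t\<^sup>2 * (2 - \<kappa>\<^sup>2) \<le> 1"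
proof -
  \<comment> \<open>The vector \<open>- a\<close> has the same slice through 0, hence the same
    \<open>t\<close>, while its density is reflected; a negative coordinate of \<open>a\<close>
    becomes a positive one.\<close>
  interpret neg: simplex_slice "- a" b "- \<kappa>" D k
    using card frame coord_sum_b b_a coord_sum_a norm_a D_pos D_sq
    by unfold_locales (auto simp: coord_sum_def sum_negf)
  have "section_vol (neg.plane_point 1 0) = section_vol (plane_point 1 0)"
    using neg.plane_point_props[of 1 0] by (intro section_vol_cong) (auto simp: plane_point_props)
  then have t': "neg.slice_density 0 = ennreal t"
    using t by (simp add: slice_density_0 neg.slice_density_0 neg.section_vol_def section_vol_def)
  obtain f where f: "sum_density UNIV (($) a) f" and lc: "logconc f"
    using ex_logconc_sum_density[of UNIV i "($) a"] i by auto
  note [measurable] = sum_density_measurable[OF f]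
  have f': "sum_density UNIV (($) (- a)) (\<lambda>y. f (- y))"
  proof -
    have "($) (- a) = (\<lambda>j. - a $ j)" by (simp add: fun_eq_iff)
    then show ?thesis using sum_density_reflect[OF f] by (simp only:)
  qed
  have lc': "logconc (\<lambda>y. f (- y))" by (rule logconc_reflect[OF lc])
  have S: "(\<Sum>j\<in>UNIV. a $ j) = \<kappa>" "(\<Sum>j\<in>UNIV. (a $ j)\<^sup>2) = 1"
    using coord_sum_a norm_a by (auto simp: coord_sum_def inner_vec_def power2_eq_square)
  from f obtain p q m1 m2 s1 s2 where
    nonneg: "0 \<le> p" "0 \<le> q" "0 \<le> m1" "0 \<le> m2" "0 \<le> s1" "0 \<le> s2"
    and sums: "p + q = 1" "m1 - m2 = \<kappa>" "s1 + s2 = (\<kappa>\<^sup>2 + 1) / 2"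
    and tails: "tail f 0 = ennreal p" "tail (tail f) 0 = ennreal m1" "tail (tail (tail f)) 0 = ennreal s1"
    "tail (\<lambda>y. f (- y)) 0 = ennreal q" "tail (tail (\<lambda>y. f (- y))) 0 = ennreal m2"
    "tail (tail (tail (\<lambda>y. f (- y)))) 0 = ennreal s2"
    by (rule sum_density_half_moments[OF finite_class.finite_UNIV]) (simp only: S)
  have ps: "p * s1 \<le> m1\<^sup>2"
    using logconc_tail_tail_le[OF _ logconc_tail[OF _ lc], of 0] nonneg
    by (simp add: tails ennreal_mult[symmetric] ennreal_power)
  have qs: "q * s2 \<le> m2\<^sup>2"
    using logconc_tail_tail_le[OF _ logconc_tail[OF _ lc'], of 0] nonneg
    by (simp add: tails ennreal_mult[symmetric] ennreal_power)
  show ?thesis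
  proof (rule half_moments_bound[OF t(2) nonneg sums _ _ ps qs])
    show "t * m1 \<le> p\<^sup>2" by (rule slice_density_0_moment_bound[OF i f lc t tails(1) nonneg(1) tails(2) nonneg(3)])
    show "t * m2 \<le> q\<^sup>2"
      using j by (intro neg.slice_density_0_moment_bound[OF _ f' lc' t' t(2) tails(4) nonneg(2) tails(5) nonneg(4), of j]) simp
    show "s1 = 0" if "p = 0"
      using tail_tail_tail_eq_0[of f 0] that tails nonneg by simp
    show "s2 = 0" if "q = 0"
      using tail_tail_tail_eq_0[of "\<lambda>y. f (- y)" 0] that tails nonneg by simp
  qed
qed

text \<open>The explicit density for two nonzero coordinates is compared with level 0 through the
  negative coordinate, and \<open>y\<close> tends to 0 from the right.\<close>

lemma slice_density_0_lower:
  assumes ij: "0 < a $ i" "a $ j < 0" and z: "\<And>l. l \<noteq> i \<Longrightarrow> l \<noteq> j \<Longrightarrow> a $ l = 0"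
    and t: "slice_density 0 = ennreal t" "0 \<le> t"
  shows "1 / (a $ i - a $ j) \<le> t"
proof -
  have f: "sum_density UNIV (($) a) (expconv (a $ j) (scaled_expd (a $ i)))"
    using ij z by (intro sum_density_two) auto
  have "1 / (a $ i - a $ j) \<le> exp (0 / a $ i) * (exp (- 0 / a $ j) * t)"
  proof (rule AE_right_limit[OF sum_density_AE_unique[OF f sum_density_slice_density]])
    show "isCont (\<lambda>y. exp (y / a $ i) * (exp (- y / a $ j) * t)) 0"
      using ij by (intro continuous_intros) auto
    fix y :: real assume y: "0 < y" and eq: "expconv (a $ j) (scaled_expd (a $ i)) y = slice_density y"
    have "ennreal (exp (- y / a $ i) / (a $ i - a $ j)) \<le> ennreal (exp (- y / a $ j)) * ennreal t"
      using slice_density_le_0[OF ij(2), of y] y by (simp add: eq[symmetric] expconv_scaled_expd ij t)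
    then have "exp (- y / a $ i) / (a $ i - a $ j) \<le> exp (- y / a $ j) * t"
      using t by (simp add: ennreal_mult[symmetric])
    \<comment> \<open>The factor makes the left side constant in \<open>y\<close>, as
      \<open>AE_right_limit\<close> requires.\<close>
    then have "exp (y / a $ i) * (exp (- y / a $ i) / (a $ i - a $ j)) \<le> exp (y / a $ i) * (exp (- y / a $ j) * t)"
      by (rule mult_left_mono) simp
    then show "1 / (a $ i - a $ j) \<le> exp (y / a $ i) * (exp (- y / a $ j) * t)"
      by (simp add: mult.assoc[symmetric] exp_add[symmetric])
  qed
  then show ?thesis by simp
qed

end

section \<open>Volume of the slice of the simplex\<close>

lemma simplex_hyperplane_eq:
  "unit_simplex \<inter> hyperplane a = {x. x \<in> nonneg_orthant \<and> coord_sum x = 1 \<and> x \<bullet> a = 0}"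
  by (auto simp: unit_simplex_def hyperplane_def nonneg_orthant_def coord_sum_def)

text \<open>The coordinate set is measurable for the product measure itself, so
  \<open>completion\<close> gives it the same value; the base point matters only through its
  coordinate sum and its inner product with \<open>a\<close>.\<close>

lemma (in simplex_slice) flat_frame_volume:
  assumes p: "coord_sum p = 1" "p \<bullet> a = 0"
  shows "emeasure (lebesgue_k k) {c \<in> space (lebesgue_k k). frame_map k (p, b) c \<in> unit_simplex \<inter> hyperplane a}
    = ennreal (D / fact k) * slice_density 0"
proof -
  let ?M = "\<Pi>\<^sub>M i\<in>{..<k}. lborel :: real measure"
  let ?A = "{c \<in> space ?M. p + (\<Sum>i<k. c i *\<^sub>R b i) \<in> nonneg_orthant}"
  have [measurable]: "?A \<in> sets ?M" by measurable
  have "{c \<in> space (lebesgue_k k). frame_map k (p, b) c \<in> unit_simplex \<inter> hyperplane a} = ?A"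
    unfolding simplex_hyperplane_eq lebesgue_k_def
    by (auto simp: frame_map_def p coord_sum_b b_a inner_add_left inner_sum_left)
  then have "emeasure (lebesgue_k k) {c \<in> space (lebesgue_k k). frame_map k (p, b) c \<in> unit_simplex \<inter> hyperplane a}
    = emeasure ?M ?A"
    by (simp add: lebesgue_k_def)
  also have "\<dots> = (\<integral>\<^sup>+c. indicator ?A c \<partial>?M)" by simp
  also have "\<dots> = section_vol p"
    unfolding section_vol_def by (intro nn_integral_cong) (auto split: split_indicator)
  also have "\<dots> = section_vol (plane_point 1 0)" using p by (intro section_vol_cong) (auto simp: plane_point_props)
  also have "\<dots> = ennreal (D / fact k) * slice_density 0"
    using D_pos by (simp add: slice_density_0 mult.assoc[symmetric] ennreal_mult[symmetric])
  finally show ?thesis .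
qed

lemma inner_pos_orthant_exists:
  fixes a :: "real^'m"
  assumes i: "0 < a $ i" and j: "a $ j < 0"
  shows "\<exists>x. (\<forall>l. 0 < x $ l) \<and> coord_sum x = 1 \<and> x \<bullet> a = 0"
proof -
  \<comment> \<open>The vector of ones has inner product \<open>coord_sum a\<close> with
    \<open>a\<close>; a nonnegative multiple of the axis whose coordinate in \<open>a\<close> has
    the opposite sign cancels it.\<close>
  define y :: "real^'m" where
    "y = (\<chi> l. 1) + (if 0 \<le> coord_sum a then axis j (coord_sum a / - (a $ j)) else axis i (- coord_sum a / a $ i))"
  have y: "0 < y $ l" for l
    using i j by (auto simp: y_def axis_def divide_nonneg_pos add_pos_nonneg divide_nonneg_neg divide_nonpos_neg
        divide_neg_pos add_pos_pos)
  have ya: "y \<bullet> a = 0"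
    using i j by (auto simp: y_def inner_add_left inner_const_eq_coord_sum inner_axis')
  have "0 < coord_sum y" unfolding coord_sum_def using y by (intro sum_pos) auto
  then show ?thesis
    using y ya by (intro exI[of _ "(1 / coord_sum y) *\<^sub>R y"]) auto
qed

text \<open>The bound on \<open>coord_sum a\<close> is the strict Cauchy-Schwarz inequality, so
  \<open>a\<close> and \<open>(1, ..., 1)\<close> are independent and their orthogonal complement
  has codimension 2.\<close>

lemma dim_coord_sum_inner_kernel:
  fixes a :: "real^'m"
  assumes card: "CARD('m) = k + 2" and a: "a \<bullet> a = 1" and \<kappa>: "(coord_sum a)\<^sup>2 < real k + 2"
  shows "dim {x :: real^'m. coord_sum x = 0 \<and> x \<bullet> a = 0} = k"
proof -
  let ?e = "(\<chi> l. 1) :: real^'m"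
  have e: "?e \<bullet> ?e = real k + 2" by (simp add: inner_const_eq_coord_sum card)
  have "?e \<noteq> a" using e a by auto
  moreover have "independent {?e, a}"
  proof -
    have "?e \<notin> span {a}"
    proof
      assume "?e \<in> span {a}"
      then obtain c where c: "?e = c *\<^sub>R a" by (auto simp: span_singleton)
      then have "?e \<bullet> a = c" using a by simp
      moreover have "?e \<bullet> ?e = c * c" using a c by simp
      ultimately show False using e \<kappa> by (simp add: inner_const_eq_coord_sum power2_eq_square)
    qed
    moreover have "a \<noteq> 0" using a by auto
    ultimately show ?thesis by (simp add: independent_insert)
  qed
  ultimately have d: "dim (span {?e, a}) = 2"
    by (simp add: dim_eq_card_independent)
  have "{y \<in> UNIV. \<forall>x\<in>span {?e, a}. orthogonal x y} = {x. coord_sum x = 0 \<and> x \<bullet> a = 0}"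
  proof (intro set_eqI iffI)
    fix y assume "y \<in> {y \<in> UNIV. \<forall>x\<in>span {?e, a}. orthogonal x y}"
    then have "orthogonal ?e y" "orthogonal a y" by (auto simp: span_base)
    then show "y \<in> {x. coord_sum x = 0 \<and> x \<bullet> a = 0}"
      by (auto simp: orthogonal_def inner_const_eq_coord_sum inner_commute)
  next
    fix y assume y: "y \<in> {x. coord_sum x = 0 \<and> x \<bullet> a = 0}"
    have "orthogonal y x" if "x \<in> span {?e, a}" for x
      using that by (rule orthogonal_to_span) (use y in \<open>auto simp: orthogonal_def inner_const_eq_coord_sum\<close>)
    then show "y \<in> {y \<in> UNIV. \<forall>x\<in>span {?e, a}. orthogonal x y}"
      by (auto simp: orthogonal_commute)
  qed
  then show ?thesis
    using dim_subspace_orthogonal_to_vectors[of "span {?e, a}" UNIV] d by (simp add: card)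
qed

lemma span_frame_subset:
  fixes b :: "nat \<Rightarrow> 'a::real_vector"
  shows "span (b ` {..<k}) \<subseteq> range (\<lambda>c. \<Sum>i<k. c i *\<^sub>R b i)"
proof (rule span_minimal)
  show "b ` {..<k} \<subseteq> range (\<lambda>c. \<Sum>i<k. c i *\<^sub>R b i)"
  proof clarify
    fix i assume "i < k"
    then have "b i = (\<Sum>j<k. (if j = i then 1 else 0) *\<^sub>R b j)"
      by (simp add: if_distrib[of "\<lambda>r. r *\<^sub>R _"] cong: if_cong)
    then show "b i \<in> range (\<lambda>c. \<Sum>i<k. c i *\<^sub>R b i)"
      by (rule range_eqI[of _ _ "\<lambda>j. if j = i then 1 else 0"])
  qed
  show "subspace (range (\<lambda>c. \<Sum>i<k. c i *\<^sub>R b i))"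
  proof (rule subspaceI)
    show "0 \<in> range (\<lambda>c. \<Sum>i<k. c i *\<^sub>R b i)"
      by (rule range_eqI[of _ _ "\<lambda>_. 0"]) simp
  next
    fix x y assume "x \<in> range (\<lambda>c. \<Sum>i<k. c i *\<^sub>R b i)" "y \<in> range (\<lambda>c. \<Sum>i<k. c i *\<^sub>R b i)"
    then obtain c d where "x = (\<Sum>i<k. c i *\<^sub>R b i)" "y = (\<Sum>i<k. d i *\<^sub>R b i)" by blast
    then show "x + y \<in> range (\<lambda>c. \<Sum>i<k. c i *\<^sub>R b i)"
      by (intro range_eqI[of _ _ "\<lambda>i. c i + d i"]) (simp add: scaleR_left_distrib sum.distrib)
  next
    fix r x assume "x \<in> range (\<lambda>c. \<Sum>i<k. c i *\<^sub>R b i)"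
    then obtain c where "x = (\<Sum>i<k. c i *\<^sub>R b i)" by blast
    then show "r *\<^sub>R x \<in> range (\<lambda>c. \<Sum>i<k. c i *\<^sub>R b i)"
      by (intro range_eqI[of _ _ "\<lambda>i. r * c i"]) (simp add: scaleR_sum_right)
  qed
qed

lemma frame_map_diff:
  assumes "x \<in> frame_map k F ` C" "y \<in> frame_map k F ` C"
  shows "x - y \<in> span (snd F ` {..<k})"
proof -
  obtain c d where "x - y = (\<Sum>i<k. c i *\<^sub>R snd F i) - (\<Sum>i<k. d i *\<^sub>R snd F i)"
    using assms by (cases F) (auto simp: frame_map_def)
  then show ?thesis
    by (simp only:) (rule span_diff; rule span_sum; rule span_scale; rule span_base; simp)
qed

lemma ex_orthonormal_frame:
  fixes U :: "'a::euclidean_space set"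
  assumes "subspace U" "dim U = k"
  shows "\<exists>b. orthonormal_frame k b \<and> span (b ` {..<k}) = U"
proof -
  obtain B where B: "B \<subseteq> U" "pairwise orthogonal B" "\<And>x. x \<in> B \<Longrightarrow> norm x = 1"
    "independent B" "card B = dim U" "span B = U"
    using orthonormal_basis_subspace[OF assms(1)] by blast
  then obtain b where b: "bij_betw b {..<k} B"
    using ex_bij_betw_nat_finite[of B] assms(2) by (auto simp: atLeast0LessThan dest: finiteI_independent)
  have "b i \<bullet> b j = (if i = j then 1 else 0)" if "i < k" "j < k" for i j
  proof (cases "i = j")
    case True
    have "b i \<in> B" using b that by (auto simp: bij_betw_def)
    then show ?thesis using True B(3) by (simp add: norm_eq_1)
  next
    case False
    then have "b i \<in> B" "b j \<in> B" "b i \<noteq> b j"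
      using b that by (auto simp: bij_betw_def inj_on_def)
    then show ?thesis using False B(2) by (simp add: pairwise_def orthogonal_def)
  qed
  then have "orthonormal_frame k b" by (simp add: orthonormal_frame_def)
  moreover have "b ` {..<k} = B" using b by (simp add: bij_betw_def)
  ultimately show ?thesis using B(6) by blast
qed

text \<open>
  The frame chosen by \<open>flat_vol\<close> has to span the direction space of the slice, because the slice
  contains a point with positive coordinates and hence a neighbourhood of it.
\<close>

lemma flat_vol_frame:
  fixes a :: "real^'m"
  assumes card: "CARD('m) = k + 2" and a: "a \<bullet> a = 1" and \<kappa>: "(coord_sum a)\<^sup>2 < real k + 2"
    and ij: "0 < a $ i" "a $ j < 0"
  obtains p b where "simplex_slice a b (coord_sum a) (sqrt (real k + 2 - (coord_sum a)\<^sup>2)) k"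
    "coord_sum p = 1" "p \<bullet> a = 0"
    "flat_vol k (unit_simplex \<inter> hyperplane a) = emeasure (lebesgue_k k)
      {c \<in> space (lebesgue_k k). frame_map k (p, b) c \<in> unit_simplex \<inter> hyperplane a}"
proof -
  define U :: "(real^'m) set" where "U = {x. coord_sum x = 0 \<and> x \<bullet> a = 0}"
  define S where "S = unit_simplex \<inter> hyperplane a"
  have S: "S = {x. x \<in> nonneg_orthant \<and> coord_sum x = 1 \<and> x \<bullet> a = 0}"
    by (simp add: S_def simplex_hyperplane_eq)
  have U: "subspace U" unfolding U_def subspace_def by (auto simp: inner_add_left) (simp add: coord_sum_def)
  have dimU: "dim U = k" unfolding U_def using card a \<kappa> by (rule dim_coord_sum_inner_kernel)
  obtain x0 where x0: "\<And>l. 0 < x0 $ l" "coord_sum x0 = 1" "x0 \<bullet> a = 0"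
    using inner_pos_orthant_exists[OF ij] by blast
  have "x0 \<in> S" using x0 by (auto simp: S nonneg_orthant_def less_imp_le)
  have sp: "space (lebesgue_k k) = (\<Pi>\<^sub>E i\<in>{..<k}. UNIV)" by (simp add: lebesgue_k_def space_PiM)
  \<comment> \<open>The predicate inside \<open>flat_vol\<close>. A witness is needed before
    anything is known about the chosen frame.\<close>
  define P where "P F \<longleftrightarrow> orthonormal_frame k (snd F) \<and> S \<subseteq> frame_map k F ` space (lebesgue_k k)" for F
  have "\<exists>F. P F"
  proof -
    obtain b where b: "orthonormal_frame k b" "span (b ` {..<k}) = U"
      using ex_orthonormal_frame[OF U dimU] by blast
    have "x \<in> frame_map k (x0, b) ` space (lebesgue_k k)" if "x \<in> S" for x
    proof -
      have "x - x0 \<in> span (b ` {..<k})"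
        unfolding b(2) using that x0 by (auto simp: S U_def inner_diff_left)
      then obtain c where c: "x - x0 = (\<Sum>i<k. c i *\<^sub>R b i)"
        using span_frame_subset by blast
      have "x = frame_map k (x0, b) (restrict c {..<k})"
        using c by (simp add: frame_map_def algebra_simps)
      then show ?thesis by (rule image_eqI[where x = "restrict c {..<k}"]) (simp add: sp)
    qed
    then have "P (x0, b)" using b by (auto simp: P_def)
    then show ?thesis ..
  qed
  define F where "F = (SOME F. P F)"
  have "P F" unfolding F_def using \<open>\<exists>F. P F\<close> by (rule someI_ex)
  obtain p b where F: "F = (p, b)" by (cases F)
  have frame: "orthonormal_frame k b" and sub: "S \<subseteq> frame_map k (p, b) ` space (lebesgue_k k)"
    using \<open>P F\<close> by (auto simp: P_def F)
  have "U \<subseteq> span (b ` {..<k})"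
  proof
    fix v assume v: "v \<in> U"
    define m where "m = Min (range (($) x0))"
    have m: "0 < m" "\<And>l. m \<le> x0 $ l" using x0 by (auto simp: m_def)
    \<comment> \<open>Small enough that \<open>d * \<bar>v $ l\<bar> <= m <= x0 $ l\<close> for all
      \<open>l\<close>; the summand 1 covers \<open>v = 0\<close>.\<close>
    define d where "d = m / (1 + norm v)"
    have d: "0 < d" using m by (auto simp: d_def add_pos_nonneg)
    have "0 \<le> (x0 + d *\<^sub>R v) $ l" for l
    proof -
      have "d * \<bar>v $ l\<bar> \<le> d * (1 + norm v)"
        using d component_le_norm_cart[of v l] by (intro mult_left_mono) auto
      also have "\<dots> = m" using norm_ge_zero[of v] by (simp add: d_def add_nonneg_eq_0_iff)
      finally have "d * \<bar>v $ l\<bar> \<le> x0 $ l" using m(2)[of l] by simp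
      moreover have "\<bar>d * v $ l\<bar> = d * \<bar>v $ l\<bar>" using d by (simp add: abs_mult)
      ultimately show ?thesis by simp
    qed
    then have "x0 + d *\<^sub>R v \<in> S"
      using v x0 by (simp add: S nonneg_orthant_def U_def inner_add_left)
    then have "(x0 + d *\<^sub>R v) - x0 \<in> span (snd (p, b) ` {..<k})"
      by (rule frame_map_diff[OF subsetD[OF sub] subsetD[OF sub \<open>x0 \<in> S\<close>]])
    then have "d *\<^sub>R v \<in> span (b ` {..<k})" by simp
    then have "(1 / d) *\<^sub>R (d *\<^sub>R v) \<in> span (b ` {..<k})" by (rule span_scale)
    then show "v \<in> span (b ` {..<k})" using d by simp
  qed
  \<comment> \<open>The span has only \<open>k\<close> generators, so containing \<open>U\<close> it
    equals \<open>U\<close>.\<close>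
  moreover have "dim (span (b ` {..<k})) \<le> dim U"
    using dim_le_card'[of "b ` {..<k}"] card_image_le[of "{..<k}" b] by (simp add: dimU)
  ultimately have eq: "U = span (b ` {..<k})"
    using U by (intro subspace_dim_equal) auto
  have b: "coord_sum (b i) = 0" "b i \<bullet> a = 0" if "i < k" for i
  proof -
    have "b i \<in> U" unfolding eq using that by (intro span_base) auto
    then show "coord_sum (b i) = 0" "b i \<bullet> a = 0" by (auto simp: U_def)
  qed
  obtain c where c: "x0 = p + (\<Sum>i<k. c i *\<^sub>R b i)"
    using sub \<open>x0 \<in> S\<close> by (auto simp: frame_map_def)
  show ?thesis
  proof (rule that[of b p])
    show "simplex_slice a b (coord_sum a) (sqrt (real k + 2 - (coord_sum a)\<^sup>2)) k"
      using card frame b a \<kappa> by unfold_locales auto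
    show "coord_sum p = 1" using x0(2) b by (simp add: c)
    show "p \<bullet> a = 0" using x0(3) b by (simp add: c inner_add_left inner_sum_left)
    show "flat_vol k (unit_simplex \<inter> hyperplane a) = emeasure (lebesgue_k k)
      {c \<in> space (lebesgue_k k). frame_map k (p, b) c \<in> unit_simplex \<inter> hyperplane a}"
      unfolding flat_vol_def S_def[symmetric] P_def[symmetric] F_def[symmetric] F by simp
  qed
qed

text \<open>Nonnegative coordinates of a unit vector lie in \<open>[0, 1]\<close>, where squares are
  at most the numbers themselves; the coordinate sum would be at least 1.\<close>

lemma ex_negative_coordinate:
  fixes a :: "real^'m"
  assumes "a \<bullet> a = 1" "coord_sum a < 1"
  shows "\<exists>j. a $ j < 0"
proof (rule ccontr)
  assume "\<not> ?thesis"
  then have nn: "0 \<le> a $ j" for j by (simp add: not_less)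
  have sq: "(\<Sum>j\<in>UNIV. a $ j * a $ j) = 1" using assms(1) by (simp add: inner_vec_def)
  have "a $ j * a $ j \<le> a $ j" for j
  proof -
    have "a $ j * a $ j \<le> (\<Sum>j\<in>UNIV. a $ j * a $ j)"
      by (rule member_le_sum) auto
    then have "a $ j \<le> 1" using sq by (intro power2_le_imp_le[of "a $ j" 1]) (auto simp: power2_eq_square)
    then show ?thesis using nn[of j] by (simp add: mult_left_le)
  qed
  then have "1 \<le> coord_sum a" unfolding coord_sum_def sq[symmetric] by (intro sum_mono)
  then show False using assms(2) by simp
qed

text \<open>The witness is \<open>slice_density 0\<close>. The last clause matches the upper bound
  when only two coordinates, of opposite sign, are nonzero, since then
  \<open>(a $ i - a $ j)^2 = 2 - (coord_sum a)^2\<close>.\<close>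

lemma slice_volume:
  fixes a :: "real^'m"
  assumes card: "CARD('m) = k + 2" and a: "a \<bullet> a = 1" and \<kappa>: "\<bar>coord_sum a\<bar> < 1"
  shows "\<exists>t. t \<le> 1 / sqrt (2 - (coord_sum a)\<^sup>2)
    \<and> flat_vol k (unit_simplex \<inter> hyperplane a)
      = ennreal (sqrt (real k + 2 - (coord_sum a)\<^sup>2) / fact k * t)
    \<and> (\<forall>i j. 0 < a $ i \<longrightarrow> a $ j < 0 \<longrightarrow> (\<forall>l. l \<noteq> i \<longrightarrow> l \<noteq> j \<longrightarrow> a $ l = 0) \<longrightarrow> 1 / (a $ i - a $ j) \<le> t)"
proof -
  have \<kappa>2: "(coord_sum a)\<^sup>2 < 1" using \<kappa> by (simp add: abs_square_less_1)
  have lt: "coord_sum a < 1" "coord_sum (- a) < 1"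
    using \<kappa> by (auto simp: abs_less_iff coord_sum_def sum_negf)
  obtain j where j: "a $ j < 0" using ex_negative_coordinate[OF a lt(1)] by blast
  obtain i where i: "0 < a $ i"
    using ex_negative_coordinate[of "- a"] a lt(2) by auto
  obtain p b where slice: "simplex_slice a b (coord_sum a) (sqrt (real k + 2 - (coord_sum a)\<^sup>2)) k"
    and p: "coord_sum p = 1" "p \<bullet> a = 0"
    and vol: "flat_vol k (unit_simplex \<inter> hyperplane a) = emeasure (lebesgue_k k)
      {c \<in> space (lebesgue_k k). frame_map k (p, b) c \<in> unit_simplex \<inter> hyperplane a}"
    by (rule flat_vol_frame[OF card a _ i j]) (use \<kappa>2 in simp, rule that)
  interpret simplex_slice a b "coord_sum a" "sqrt (real k + 2 - (coord_sum a)\<^sup>2)" k by (rule slice)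
  obtain t where t: "slice_density 0 = ennreal t" "0 \<le> t"
    using slice_density_0_finite[OF i] by (cases "slice_density 0") auto
  show ?thesis
  proof (intro exI conjI allI impI)
    have "(t * sqrt (2 - (coord_sum a)\<^sup>2))\<^sup>2 \<le> 1\<^sup>2"
      using slice_density_0_upper[OF i j t] \<kappa>2 by (simp add: power_mult_distrib)
    then have "t * sqrt (2 - (coord_sum a)\<^sup>2) \<le> 1"
      by (rule power2_le_imp_le) simp
    then show "t \<le> 1 / sqrt (2 - (coord_sum a)\<^sup>2)"
      using \<kappa>2 by (simp add: pos_le_divide_eq)
    show "flat_vol k (unit_simplex \<inter> hyperplane a) = ennreal (sqrt (real k + 2 - (coord_sum a)\<^sup>2) / fact k * t)"
      using flat_frame_volume[OF p] t \<kappa>2 unfolding vol by (simp add: ennreal_mult[symmetric])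
    show "1 / (a $ i - a $ j) \<le> t"
      if "0 < a $ i" "a $ j < 0" "\<forall>l. l \<noteq> i \<longrightarrow> l \<noteq> j \<longrightarrow> a $ l = 0" for i j
      using that by (intro slice_density_0_lower[OF _ _ _ t]) auto
  qed
qed

theorem theorem4p1:
  fixes n :: nat and \<kappa> :: real
  assumes "n \<ge> 1"
    and "CARD('m::finite) = n + 1"
    and "\<bar>\<kappa>\<bar> < 1 / sqrt 2"
  shows "(\<forall>a :: real ^ 'm. (\<Sum>j\<in>UNIV. a $ j) = \<kappa> \<and> (\<Sum>j\<in>UNIV. (a $ j)\<^sup>2) = 1 \<longrightarrow>
            flat_vol (n - 1) (unit_simplex \<inter> hyperplane a)
              \<le> ennreal (sqrt (real n + 1 - \<kappa>\<^sup>2) / fact (n - 1) * (1 / sqrt (2 - \<kappa>\<^sup>2))))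
       \<and> (\<forall>i j. \<forall>a :: real ^ 'm. i \<noteq> j \<and>
            a = (\<chi> l. if l = i then \<kappa> / 2 + sqrt (1 / 2 - \<kappa>\<^sup>2 / 4)
                      else if l = j then \<kappa> / 2 - sqrt (1 / 2 - \<kappa>\<^sup>2 / 4)
                      else 0) \<longrightarrow>
            (\<Sum>j\<in>UNIV. a $ j) = \<kappa> \<and> (\<Sum>j\<in>UNIV. (a $ j)\<^sup>2) = 1 \<and>
            flat_vol (n - 1) (unit_simplex \<inter> hyperplane a)
              = ennreal (sqrt (real n + 1 - \<kappa>\<^sup>2) / fact (n - 1) * (1 / sqrt (2 - \<kappa>\<^sup>2))))"
proof (intro conjI allI impI)
  define k where "k = n - 1"
  have k: "CARD('m) = k + 2" "real n + 1 = real k + 2" using assms by (auto simp: k_def)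
  have "1 / sqrt 2 < (1 :: real)" by simp
  then have \<kappa>: "\<bar>\<kappa>\<bar> < 1" using assms(3) by linarith
  then have \<kappa>2: "\<kappa>\<^sup>2 < 1" by (simp add: abs_square_less_1)
  have le: "sqrt (real k + 2 - \<kappa>\<^sup>2) / fact k * t \<le> sqrt (real k + 2 - \<kappa>\<^sup>2) / fact k * s" if "t \<le> s" for t s
    using that \<kappa>2 by (intro mult_left_mono) auto
  {
    fix a :: "real^'m"
    assume "(\<Sum>j\<in>UNIV. a $ j) = \<kappa> \<and> (\<Sum>j\<in>UNIV. (a $ j)\<^sup>2) = 1"
    then have a: "coord_sum a = \<kappa>" "a \<bullet> a = 1" by (auto simp: coord_sum_def inner_vec_def power2_eq_square)
    obtain t where t: "t \<le> 1 / sqrt (2 - \<kappa>\<^sup>2)"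
      "flat_vol k (unit_simplex \<inter> hyperplane a) = ennreal (sqrt (real k + 2 - \<kappa>\<^sup>2) / fact k * t)"
      using slice_volume[OF k(1) a(2), unfolded a(1), OF \<kappa>] by blast
    then show "flat_vol (n - 1) (unit_simplex \<inter> hyperplane a)
              \<le> ennreal (sqrt (real n + 1 - \<kappa>\<^sup>2) / fact (n - 1) * (1 / sqrt (2 - \<kappa>\<^sup>2)))"
      unfolding k_def[symmetric] k(2) t(2) by (intro ennreal_leI le t(1))
  }
  fix i j :: 'm and a :: "real^'m"
  define r where "r = sqrt (1 / 2 - \<kappa>\<^sup>2 / 4)"
  assume "i \<noteq> j \<and> a = (\<chi> l. if l = i then \<kappa> / 2 + sqrt (1 / 2 - \<kappa>\<^sup>2 / 4)
                      else if l = j then \<kappa> / 2 - sqrt (1 / 2 - \<kappa>\<^sup>2 / 4) else 0)"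
  then have ij: "i \<noteq> j" and a_def: "a = (\<chi> l. if l = i then \<kappa> / 2 + r else if l = j then \<kappa> / 2 - r else 0)"
    by (auto simp: r_def)
  have comp: "a $ i = \<kappa> / 2 + r" "a $ j = \<kappa> / 2 - r" "\<And>l. l \<noteq> i \<Longrightarrow> l \<noteq> j \<Longrightarrow> a $ l = 0"
    using ij by (auto simp: a_def)
  have r2: "r\<^sup>2 = 1 / 2 - \<kappa>\<^sup>2 / 4" using \<kappa>2 by (simp add: r_def)
  have sum2: "(\<Sum>l\<in>UNIV. g (a $ l)) = g (\<kappa> / 2 + r) + g (\<kappa> / 2 - r)" if "g 0 = 0" for g :: "real \<Rightarrow> real"
  proof -
    have "(\<Sum>l\<in>UNIV. g (a $ l)) = (\<Sum>l\<in>{i, j}. g (a $ l))"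
      using comp that by (intro sum.mono_neutral_right) auto
    then show ?thesis using ij comp by simp
  qed
  show s1: "(\<Sum>j\<in>UNIV. a $ j) = \<kappa>" using sum2[of "\<lambda>x. x"] by simp
  show s2: "(\<Sum>j\<in>UNIV. (a $ j)\<^sup>2) = 1"
    using sum2[of "\<lambda>x. x\<^sup>2"] r2 by (simp add: power2_sum power2_diff power_divide)
  have a: "coord_sum a = \<kappa>" "a \<bullet> a = 1" using s1 s2 by (auto simp: coord_sum_def inner_vec_def power2_eq_square)
  \<comment> \<open>The product of the two nonzero coordinates is
    \<open>(\<kappa>^2 - 1) / 2 < 0\<close>, so their signs differ.\<close>
  have "\<bar>\<kappa> / 2\<bar> < r"
  proof -
    have "(\<kappa> / 2)\<^sup>2 < r\<^sup>2" using r2 \<kappa>2 by (simp add: power_divide)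
    moreover have "0 \<le> r" using \<kappa>2 by (simp add: r_def)
    ultimately show ?thesis
      by (intro power2_less_imp_less[of "\<bar>\<kappa> / 2\<bar>" r]) (simp_all only: power2_abs)
  qed
  then have pos: "0 < a $ i" "a $ j < 0" unfolding comp by auto
  have diff: "a $ i - a $ j = sqrt (2 - \<kappa>\<^sup>2)"
  proof (rule real_sqrt_unique[symmetric])
    show "(a $ i - a $ j)\<^sup>2 = 2 - \<kappa>\<^sup>2" using r2 by (simp add: comp power_mult_distrib)
  qed (use pos in simp)
  obtain t where t: "t \<le> 1 / sqrt (2 - \<kappa>\<^sup>2)"
    "flat_vol k (unit_simplex \<inter> hyperplane a) = ennreal (sqrt (real k + 2 - \<kappa>\<^sup>2) / fact k * t)"
    and "\<forall>i j. 0 < a $ i \<longrightarrow> a $ j < 0 \<longrightarrow> (\<forall>l. l \<noteq> i \<longrightarrow> l \<noteq> j \<longrightarrow> a $ l = 0) \<longrightarrow> 1 / (a $ i - a $ j) \<le> t"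
    using slice_volume[OF k(1) a(2), unfolded a(1), OF \<kappa>] by blast
  then have "1 / (a $ i - a $ j) \<le> t" using pos comp(3) by blast
  then have "t = 1 / sqrt (2 - \<kappa>\<^sup>2)" using t(1) by (simp add: diff)
  with t(2) show "flat_vol (n - 1) (unit_simplex \<inter> hyperplane a)
              = ennreal (sqrt (real n + 1 - \<kappa>\<^sup>2) / fact (n - 1) * (1 / sqrt (2 - \<kappa>\<^sup>2)))"
    unfolding k_def[symmetric] k(2) by simp
qed

end
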